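(* Let $R^F$ be the stationary piecewise deterministic Markov process on $\mathbb{R}$, with $R^F_0\sim N(0,1)$, whose (extended) generator is $$L^Ff(x)=f'(x)+x_+\bigl(\mathbb{E}[f(-\tau)]-f(x)\bigr),$$ where $\tau$ is a standard Rayleigh random variable, and for $\rho>0$ let $$\sigma_F^2(\rho):=8\int_0^\infty e^{-\rho t}\,\mathbb{E}[R^F_0R^F_t]\,dt .$$ Then $$\frac{d\sigma_F^2(\rho)}{d\rho}<0\qquad\text{for all }\rho>0.$$
   Context: Here $x_+=\max(x,0)$, and the standard Rayleigh distribution has density $xe^{-x^2/2}$ on $x>0$. The process $R^F$ moves to the right at unit speed and, when at $x$, jumps with rate $x_+$ to $-\tau$ with $\tau$ a fresh standard Rayleigh variable; it leaves $N(0,1)$ invariant. *)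

theory Defs
  imports "HOL-Probability.Probability"
begin

text \<open>
  Stochastic processes are functions \<open>X :: real \<Rightarrow> 'a \<Rightarrow> real\<close> on a probability space, of which
  only the times \<open>t \<ge> 0\<close> are relevant.
\<close>

definition natural_filtration ::
  "'a measure \<Rightarrow> (real \<Rightarrow> 'a \<Rightarrow> real) \<Rightarrow> real \<Rightarrow> 'a measure" where
  "natural_filtration M X t =
     sigma (space M) (\<Union>s\<in>{0..t}. {X s -` A \<inter> space M | A. A \<in> sets borel})"

definition markov_process :: "'a measure \<Rightarrow> (real \<Rightarrow> 'a \<Rightarrow> real) \<Rightarrow> bool" where
  "markov_process M X \<longleftrightarrow>
     (\<forall>s t. 0 \<le> s \<longrightarrow> s \<le> t \<longrightarrow>
        (\<forall>A\<in>sets borel. AE \<omega> in M.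
           real_cond_exp M (natural_filtration M X s) (\<lambda>\<omega>. indicator A (X t \<omega>)) \<omega> =
           real_cond_exp M (vimage_algebra (space M) (X s) borel) (\<lambda>\<omega>. indicator A (X t \<omega>)) \<omega>))"

text \<open>The law of the whole process is invariant under time shifts.\<close>

definition stationary_process :: "'a measure \<Rightarrow> (real \<Rightarrow> 'a \<Rightarrow> real) \<Rightarrow> bool" where
  "stationary_process M X \<longleftrightarrow>
     (\<forall>h\<ge>0. distr M (Pi\<^sub>M {0..} (\<lambda>_. borel)) (\<lambda>\<omega>. \<lambda>t\<in>{0..}. X (t + h) \<omega>) =
             distr M (Pi\<^sub>M {0..} (\<lambda>_. borel)) (\<lambda>\<omega>. \<lambda>t\<in>{0..}. X t \<omega>))"

text \<open>
  A path that follows the flow \<open>\<phi>\<close> (elapsed time first, starting point second) except at a locally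
  finite set \<open>J\<close> of jump times, at which it is right-continuous.
\<close>

definition piecewise_deterministic_path ::
  "(real \<Rightarrow> real \<Rightarrow> real) \<Rightarrow> (real \<Rightarrow> real) \<Rightarrow> bool" where
  "piecewise_deterministic_path \<phi> x \<longleftrightarrow>
     (\<exists>J\<subseteq>{0<..}. (\<forall>t. finite (J \<inter> {..t})) \<and>
        (\<forall>s t. 0 \<le> s \<longrightarrow> s \<le> t \<longrightarrow> J \<inter> {s<..t} = {} \<longrightarrow> x t = \<phi> (t - s) (x s)))"

definition martingale ::
  "'a measure \<Rightarrow> (real \<Rightarrow> 'a measure) \<Rightarrow> (real \<Rightarrow> 'a \<Rightarrow> real) \<Rightarrow> bool" where
  "martingale M F Y \<longleftrightarrow>
     (\<forall>t\<ge>0. integrable M (Y t) \<and> Y t \<in> borel_measurable (F t)) \<and>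
     (\<forall>s t. 0 \<le> s \<longrightarrow> s \<le> t \<longrightarrow> (AE \<omega> in M. real_cond_exp M (F s) (Y t) \<omega> = Y s \<omega>))"

definition local_martingale ::
  "'a measure \<Rightarrow> (real \<Rightarrow> 'a measure) \<Rightarrow> (real \<Rightarrow> 'a \<Rightarrow> real) \<Rightarrow> bool" where
  "local_martingale M F Y \<longleftrightarrow>
     (\<exists>T :: nat \<Rightarrow> 'a \<Rightarrow> real.
        (\<forall>n. stopping_time F (T n)) \<and> (\<forall>n. \<forall>\<omega>\<in>space M. 0 \<le> T n \<omega>) \<and>
        (AE \<omega> in M. incseq (\<lambda>n. T n \<omega>) \<and> filterlim (\<lambda>n. T n \<omega>) at_top sequentially) \<and>
        (\<forall>n. martingale M F (\<lambda>t \<omega>. Y (min t (T n \<omega>)) \<omega>)))"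

text \<open>
  The extended generator of \<open>X\<close> in the sense of Davis, as a relation between functions: \<open>(f, g)\<close>
  belongs to it iff \<open>f (X t) - f (X 0) - \<integral>\<^sub>0\<^sup>t g (X s) ds\<close> is a local martingale.
\<close>

definition extended_generator ::
  "'a measure \<Rightarrow> (real \<Rightarrow> 'a \<Rightarrow> real) \<Rightarrow> ((real \<Rightarrow> real) \<times> (real \<Rightarrow> real)) set" where
  "extended_generator M X =
     {(f, g). f \<in> borel_measurable borel \<and> g \<in> borel_measurable borel \<and>
        (AE \<omega> in M. \<forall>t\<ge>0. set_integrable lborel {0..t} (\<lambda>s. g (X s \<omega>))) \<and>
        local_martingale M (natural_filtration M X)
          (\<lambda>t \<omega>. f (X t \<omega>) - f (X 0 \<omega>) - (LINT s:{0..t}|lborel. g (X s \<omega>)))}"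

text \<open>
  Test functions for the generator: bounded continuously differentiable functions with bounded
  derivative. For the operator \<open>L_F\<close> below this class is large enough to determine the law of the
  process from its initial law, because for \<open>\<rho> > 0\<close> and bounded continuous \<open>g\<close> the equation
  \<open>\<rho> f - L_F f = g\<close> has a solution \<open>f\<close> in it.
\<close>

definition C1_bounded :: "(real \<Rightarrow> real) set" where
  "C1_bounded = {f. (\<forall>x. f differentiable (at x)) \<and> continuous_on UNIV (deriv f) \<and>
                    bounded (range f) \<and> bounded (range (deriv f))}"

definition rayleigh :: "real measure" where
  "rayleigh = density lborel (\<lambda>x. ennreal (if x > 0 then x * exp (- x\<^sup>2 / 2) else 0))"

definition L_F :: "(real \<Rightarrow> real) \<Rightarrow> real \<Rightarrow> real" where
  "L_F f x = deriv f x + max x 0 * ((\<integral>u. f (- u) \<partial>rayleigh) - f x)"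

definition sigma2_F :: "'a measure \<Rightarrow> (real \<Rightarrow> 'a \<Rightarrow> real) \<Rightarrow> real \<Rightarrow> real" where
  "sigma2_F M R \<rho> =
     8 * (LINT t:{0..}|lborel. exp (- \<rho> * t) * (\<integral>\<omega>. R 0 \<omega> * R t \<omega> \<partial>M))"

end

theory Submission
  imports Defs
begin

text \<open>
  The resolvent equation \<open>\<rho> f - L_F f = x\<close> can be solved by hand, which gives, with \<open>\<tau>\<close> a standard Rayleigh
  variable, \<open>p = E[1 - exp (- \<rho> \<tau>)]\<close> and \<open>a = 1/\<rho> \<integral>\<^sub>0\<^sup>\<rho> p\<close>,
  \<open>\<sigma>\<^sub>F\<^sup>2(\<rho>) = 8 / sqrt (2 \<pi>) (1 - a\<^sup>2 / (p (2 - p)))\<close>.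
  Since \<open>p\<close> is increasing and concave in \<open>\<rho>\<close>, \<open>a' = (p - a) / \<rho> \<ge> p' / 2\<close>; in particular \<open>0 < a < p < 1\<close>, and
  then \<open>a' p (2 - p) \<ge> p' p (2 - p) / 2 > p' a (1 - p)\<close> says that \<open>a\<^sup>2 / (p (2 - p))\<close> is strictly increasing.

  The solution \<open>f\<close> grows linearly at \<open>- \<infinity>\<close>, so it is replaced by bounded functions \<open>f\<^sub>N\<close> for which
  \<open>\<rho> f\<^sub>N - L_F f\<^sub>N\<close> is explicit, of uniformly linear growth and tends to \<open>x\<close>. For bounded \<open>f\<close>,
  testing the stopped martingale against \<open>R\<^sub>0\<close> and dominated convergence turn the local martingale problem into \<open>\<integral>\<^sub>0\<^sup>\<infinity> exp (- \<rho> t) E[R\<^sub>0 (\<rho> f - L_F f)(R\<^sub>t)] dt = E[R\<^sub>0 f(R\<^sub>0)]\<close>.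
\<close>

subsection \<open>Gaussian moments on the half-line and the Mills ratio\<close>

text \<open>Write m for the Mills ratio \<open>gauss_moment 0\<close>. With c = 1 + E[f(-\<tau>)]
  the resolvent equation reads f' = (\<rho> + x) f - c x on the right and f' = \<rho> f - x on the
  left. Since m'(y) = y m(y) - 1, the bounded solution on the right is c (1 - \<rho> m(\<rho> + x));
  on the left the solutions are x / \<rho> + 1 / \<rho>^2 + b exp(\<rho> x), and continuity at 0
  fixes b. Inserting this into the definition of c leaves c p (2 - p) = a, where p (2 - p) is 1 -
  E[exp(-\<rho> \<tau>)]^2. The factor 1 / sqrt (2 \<pi>) appears because x times the normal density
  is, up to this factor and a sign on the left, the Rayleigh density at |x|. Hence E[R_0 f(R_0)]
  needs only E[f(\<tau>)] = c (1 - a) and E[f(-\<tau>)] = c - 1. Boundedness of the test functions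
  matters because the stopped martingales must be dominated over a whole time interval, while
  stationarity controls R at single times only. For bounded f the unbounded term L_F f(R_s) occurs
  only under a time integral, where Fubini applies.\<close>

lemma set_integral_FTC_atLeast:
  fixes F f :: "real \<Rightarrow> real"
  assumes int: "set_integrable lborel {a..} f"
    and der: "\<And>x. a \<le> x \<Longrightarrow> (F has_real_derivative f x) (at x)"
    and cont: "continuous_on {a..} f"
    and lim: "(F \<longlongrightarrow> l) at_top"
  shows "(LINT x:{a..}|lborel. f x) = l - F a"
proof -
  have "((\<lambda>b. LINT x:{a..b}|lborel. f x) \<longlongrightarrow> (LINT x:{a..}|lborel. f x)) at_top"
    by (rule tendsto_set_lebesgue_integral_at_top) (use int in auto)
  moreover have "((\<lambda>b. LINT x:{a..b}|lborel. f x) \<longlongrightarrow> l - F a) at_top"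
  proof (rule Lim_transform_eventually)
    show "((\<lambda>b. F b - F a) \<longlongrightarrow> l - F a) at_top"
      by (intro tendsto_intros lim)
    show "\<forall>\<^sub>F b in at_top. F b - F a = (LINT x:{a..b}|lborel. f x)"
      using eventually_ge_at_top[of a]
    proof eventually_elim
      case (elim b)
      have "(F has_vector_derivative f x) (at x within {a..b})" if "a \<le> x" for x
        using der[OF that] has_field_derivative_at_within
          has_real_derivative_iff_has_vector_derivative by blast
      then show ?case
        using integral_FTC_atLeastAtMost[of a b F f] elim continuous_on_subset[OF cont, of "{a..b}"]
        by (auto simp: set_lebesgue_integral_def)
    qed
  qed
  ultimately show ?thesis
    using tendsto_unique trivial_limit_at_top_linorder by blast
qed

text \<open>\<open>gauss_moment 0\<close> is the Mills ratio of the standard normal law and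
  \<open>gauss_moment 1\<close> the Laplace transform of the Rayleigh law; formally, differentiation
  in y raises k by one and changes the sign.\<close>

definition gauss_moment :: "nat \<Rightarrow> real \<Rightarrow> real" where
  "gauss_moment k y = (LINT x:{0..}|lborel. x ^ k * exp (- (y * x) - x\<^sup>2 / 2))"

lemma gauss_halfline_integrable:
  "set_integrable lborel {0..} (\<lambda>x::real. x ^ k * exp (- (x\<^sup>2 / 2)))"
proof -
  have "integrable lborel (\<lambda>x. sqrt (2 * pi) * (std_normal_density x * x ^ k))"
    by (intro integrable_mult_right integrable_std_normal_moment)
  then have "integrable lborel (\<lambda>x::real. x ^ k * exp (- (x\<^sup>2 / 2)))"
    by (simp add: std_normal_density_def mult_ac)
  then show ?thesis
    unfolding set_integrable_def by (rule integrable_mult_indicator[rotated]) simp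
qed

lemma gauss_dominated_integrable:
  fixes f :: "real \<Rightarrow> real"
  assumes [measurable]: "f \<in> borel_measurable borel"
    and "\<And>x. x \<ge> 0 \<Longrightarrow> \<bar>f x\<bar> \<le> C * x ^ k"
  shows "set_integrable lborel {0..} (\<lambda>x. f x * exp (- (x\<^sup>2 / 2)))"
proof (rule set_integrable_bound)
  show "set_integrable lborel {0..} (\<lambda>x::real. C * (x ^ k * exp (- (x\<^sup>2 / 2))))"
    by (intro set_integrable_mult_right gauss_halfline_integrable)
  show "set_borel_measurable lborel {0..} (\<lambda>x. f x * exp (- (x\<^sup>2 / 2)))"
    unfolding set_borel_measurable_def by measurable
  show "AE x in lborel. x \<in> {0..} \<longrightarrow> norm (f x * exp (- (x\<^sup>2 / 2))) \<le> norm (C * (x ^ k * exp (- (x\<^sup>2 / 2))))"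
    using assms(2) by (auto intro!: AE_I2 simp: abs_mult mult.assoc[symmetric] intro!: mult_right_mono)
       (smt (verit) mult_nonneg_nonneg mult_nonpos_nonneg zero_le_power)
qed

lemma gauss_moment_integrand: "x ^ k * exp (- (y * x) - x\<^sup>2 / 2) = x ^ k * exp (- (y * x)) * exp (- (x\<^sup>2 / 2))"
  for x y :: real
  by (simp add: mult_exp_exp)

lemma gauss_moment_integrable:
  assumes "y \<ge> 0"
  shows "set_integrable lborel {0..} (\<lambda>x::real. x ^ k * exp (- (y * x) - x\<^sup>2 / 2))"
  unfolding gauss_moment_integrand
  by (rule gauss_dominated_integrable[where C = 1 and k = k])
     (use assms in \<open>auto simp: abs_mult intro!: mult_left_le\<close>)

text \<open>Positivity is asked only off the endpoint, because integrands with a factor x ^ k vanish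
  at 0. A vanishing integral would make the interval (0, 1) a null set.\<close>

lemma set_integral_pos:
  fixes f :: "real \<Rightarrow> real"
  assumes int: "set_integrable lborel {0..} f" and pos: "\<And>x. x > 0 \<Longrightarrow> f x > 0"
  shows "(LINT x:{0..}|lborel. f x) > 0"
proof -
  let ?g = "\<lambda>x. indicator {0<..} x * f x"
  have ae: "AE x in lborel. indicator {0..} x *\<^sub>R f x = ?g x"
    using AE_lborel_singleton[of 0] by eventually_elim (auto simp: indicator_def)
  have i: "integrable lborel ?g"
    using set_integrable_subset[OF int, of "{0<..}"] by (simp add: set_integrable_def subset_eq)
  have "(\<integral>x. ?g x \<partial>lborel) \<noteq> 0"
  proof
    assume "(\<integral>x. ?g x \<partial>lborel) = 0"
    then have "AE x in lborel. ?g x = 0"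
      by (subst (asm) integral_nonneg_eq_0_iff_AE[OF i])
         (auto intro!: AE_I2 simp: indicator_def less_imp_le pos)
    then have "AE x in lborel. x \<notin> {0<..<1::real}"
      by eventually_elim (use pos in \<open>force simp: indicator_def\<close>)
    then have "emeasure lborel {0<..<1::real} = 0"
      by (subst (asm) AE_iff_measurable[of "{0<..<1}"]) auto
    then show False by simp
  qed
  moreover have "(\<integral>x. ?g x \<partial>lborel) \<ge> 0"
    by (intro integral_nonneg_AE AE_I2) (auto simp: indicator_def less_imp_le pos)
  moreover have "(LINT x:{0..}|lborel. f x) = (\<integral>x. ?g x \<partial>lborel)"
    unfolding set_lebesgue_integral_def
    using int i ae by (intro integral_cong_AE) (auto simp: set_integrable_def)
  ultimately show ?thesis by simp
qed

lemma gauss_moment_pos: "y \<ge> 0 \<Longrightarrow> gauss_moment k y > 0"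
  unfolding gauss_moment_def by (rule set_integral_pos[OF gauss_moment_integrable]) auto

text \<open>The total derivative of exp(- y x - x^2 / 2) integrates to -1. In terms of the Rayleigh
  law this is p = y m(y), the form in which p is used throughout.\<close>

lemma gauss_moment_1:
  assumes "y \<ge> 0"
  shows "gauss_moment 1 y = 1 - y * gauss_moment 0 y"
proof -
  let ?e = "\<lambda>x::real. exp (- (y * x) - x\<^sup>2 / 2)"
  let ?d = "\<lambda>x::real. (- 1) * (x ^ 1 * ?e x) - y * (x ^ 0 * ?e x)"
  have i: "set_integrable lborel {0..} (\<lambda>x. (- 1) * (x ^ 1 * ?e x))"
    "set_integrable lborel {0..} (\<lambda>x. y * (x ^ 0 * ?e x))"
    by (intro set_integrable_mult_right gauss_moment_integrable assms)+
  have "(LINT x:{0..}|lborel. ?d x) = 0 - ?e 0"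
  proof (rule set_integral_FTC_atLeast)
    show "set_integrable lborel {0..} ?d"
      by (intro set_integral_diff(1) i)
    show "(?e has_real_derivative ?d x) (at x)" for x
      by (auto intro!: derivative_eq_intros simp: algebra_simps)
    show "continuous_on {0..} ?d"
      by (intro continuous_intros) simp_all
    show "(?e \<longlongrightarrow> 0) at_top"
      using assms by real_asymp
  qed
  moreover have "(LINT x:{0..}|lborel. ?d x) = (- 1) * gauss_moment 1 y - y * gauss_moment 0 y"
    by (simp only: set_integral_diff(2)[OF i] gauss_moment_def set_integral_mult_right)
  ultimately show ?thesis by simp
qed

lemma gauss_moment_2:
  assumes "y \<ge> 0"
  shows "gauss_moment 2 y = gauss_moment 0 y - y * gauss_moment 1 y"
proof -
  let ?e = "\<lambda>x::real. exp (- (y * x) - x\<^sup>2 / 2)"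
  let ?d = "\<lambda>x::real. x ^ 0 * ?e x - (y * (x ^ 1 * ?e x) + x ^ 2 * ?e x)"
  have i: "set_integrable lborel {0..} (\<lambda>x. x ^ 0 * ?e x)"
    "set_integrable lborel {0..} (\<lambda>x. y * (x ^ 1 * ?e x))"
    "set_integrable lborel {0..} (\<lambda>x. x ^ 2 * ?e x)"
    by (intro set_integrable_mult_right gauss_moment_integrable assms)+
  have "(LINT x:{0..}|lborel. ?d x) = 0 - (0 * ?e 0)"
  proof (rule set_integral_FTC_atLeast)
    show "set_integrable lborel {0..} ?d"
      by (intro set_integral_diff(1) set_integral_add(1) i)
    show "((\<lambda>x. x * ?e x) has_real_derivative ?d x) (at x)" for x
      by (auto intro!: derivative_eq_intros simp: algebra_simps power2_eq_square)
    show "continuous_on {0..} ?d"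
      by (intro continuous_intros) simp_all
    show "((\<lambda>x. x * ?e x) \<longlongrightarrow> 0) at_top"
      using assms by real_asymp
  qed
  moreover have "(LINT x:{0..}|lborel. ?d x) = gauss_moment 0 y - (y * gauss_moment 1 y + gauss_moment 2 y)"
    by (simp only: set_integral_diff(2)[OF i(1) set_integral_add(1)[OF i(2,3)]]
        set_integral_add(2)[OF i(2,3)] gauss_moment_def set_integral_mult_right)
  ultimately show ?thesis by simp
qed

section \<open>Estimates and derivative of the Mills ratio\<close>

lemma mills_lt_inverse: "y > 0 \<Longrightarrow> y * gauss_moment 0 y < 1"
  using gauss_moment_1[of y] gauss_moment_pos[of y 1] by simp

text \<open>Integrate exp(- y x) > 1 - y x against exp(- x^2 / 2), whose first moment on the
  half-line is 1. This gives a > 0.\<close>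

lemma mills_drop_lt:
  assumes "y > 0"
  shows "gauss_moment 0 0 - gauss_moment 0 y < y"
proof -
  let ?e = "\<lambda>y x::real. exp (- (y * x) - x\<^sup>2 / 2)"
  let ?d = "\<lambda>x::real. x ^ 0 * ?e y x - x ^ 0 * ?e 0 x + y * (x ^ 1 * ?e 0 x)"
  have i: "set_integrable lborel {0..} (\<lambda>x. x ^ 0 * ?e y x)"
    "set_integrable lborel {0..} (\<lambda>x. x ^ 0 * ?e 0 x)"
    "set_integrable lborel {0..} (\<lambda>x. y * (x ^ 1 * ?e 0 x))"
    using assms by (intro set_integrable_mult_right gauss_moment_integrable; simp)+
  have "(LINT x:{0..}|lborel. ?d x) > 0"
  proof (rule set_integral_pos)
    show "set_integrable lborel {0..} ?d"
      by (intro set_integral_diff(1) set_integral_add(1) i)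
    show "?d x > 0" if "x > 0" for x
    proof -
      have "?d x = exp (- (x\<^sup>2 / 2)) * (exp (- (y * x)) - (1 + - (y * x)))"
        by (simp add: algebra_simps mult_exp_exp)
      moreover have "1 + - (y * x) < exp (- (y * x))"
        using exp_minus_greater assms that by auto
      ultimately show ?thesis by simp
    qed
  qed
  moreover have "(LINT x:{0..}|lborel. ?d x) = gauss_moment 0 y - gauss_moment 0 0 + y * gauss_moment 1 0"
    by (simp only: set_integral_add(2)[OF set_integral_diff(1)[OF i(1,2)] i(3)]
        set_integral_diff(2)[OF i(1,2)] gauss_moment_def set_integral_mult_right)
  ultimately show ?thesis using gauss_moment_1[of 0] by simp
qed

text \<open>The quadratic Taylor bound for exp(y x), multiplied by exp(- y x - x^2 / 2) and
  integrated. It is the integrated form of the concavity of p and yields a' \<ge> p' / 2.\<close>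

lemma mills_second_order:
  assumes "y > 0"
  shows "gauss_moment 0 y + y * gauss_moment 1 y + y\<^sup>2 / 2 * gauss_moment 2 y \<le> gauss_moment 0 0"
proof -
  let ?e = "\<lambda>y x::real. exp (- (y * x) - x\<^sup>2 / 2)"
  let ?d = "\<lambda>x::real. x ^ 0 * ?e 0 x - (x ^ 0 * ?e y x + y * (x ^ 1 * ?e y x) + y\<^sup>2 / 2 * (x ^ 2 * ?e y x))"
  have i: "set_integrable lborel {0..} (\<lambda>x. x ^ 0 * ?e 0 x)"
    "set_integrable lborel {0..} (\<lambda>x. x ^ 0 * ?e y x)"
    "set_integrable lborel {0..} (\<lambda>x. y * (x ^ 1 * ?e y x))"
    "set_integrable lborel {0..} (\<lambda>x. y\<^sup>2 / 2 * (x ^ 2 * ?e y x))"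
    using assms by (intro set_integrable_mult_right gauss_moment_integrable; simp)+
  have "(LINT x:{0..}|lborel. ?d x) \<ge> 0"
    unfolding set_lebesgue_integral_def
  proof (rule integral_nonneg_AE, rule AE_I2)
    fix x :: real
    have "?d x \<ge> 0" if "x \<ge> 0"
    proof -
    have "1 + y * x + (y * x)\<^sup>2 / 2 \<le> exp (y * x)"
      using assms that by (intro exp_lower_Taylor_quadratic) simp
    moreover have "?d x = exp (- (x\<^sup>2 / 2)) * exp (- (y * x)) * (exp (y * x) - (1 + y * x + (y * x)\<^sup>2 / 2))"
      by (simp add: algebra_simps mult_exp_exp)
    ultimately show ?thesis by simp
    qed
    then show "0 \<le> indicator {0..} x *\<^sub>R ?d x"
      by (cases "x \<ge> 0") (simp_all only: indicator_simps atLeast_iff, simp_all)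
  qed
  moreover have "(LINT x:{0..}|lborel. ?d x) = gauss_moment 0 0 - (gauss_moment 0 y + y * gauss_moment 1 y + y\<^sup>2 / 2 * gauss_moment 2 y)"
    by (simp only: set_integral_diff(2)[OF i(1) set_integral_add(1)[OF set_integral_add(1)[OF i(2,3)] i(4)]]
        set_integral_add(2)[OF set_integral_add(1)[OF i(2,3)] i(4)] set_integral_add(2)[OF i(2,3)]
        gauss_moment_def set_integral_mult_right)
  ultimately show ?thesis by simp
qed

text \<open>Completing the square turns the parameter y into a limit of integration, so that the
  derivative in y follows from the fundamental theorem of calculus without differentiating under the
  integral sign.\<close>

lemma mills_tail:
  assumes "y \<ge> 0"
  shows "gauss_moment 0 y = exp (y\<^sup>2 / 2) * (gauss_moment 0 0 - integral {0..y} (\<lambda>s. exp (- (s\<^sup>2 / 2))))"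
proof -
  let ?g = "\<lambda>s::real. exp (- (s\<^sup>2 / 2))"
  have int: "set_integrable lborel {0..} ?g"
    using gauss_halfline_integrable[of 0] by simp
  have "(LINT s:{y..}|lborel. ?g s) = (LINT x:{0..}|lborel. ?g (y + x))"
    unfolding set_lebesgue_integral_def
    by (subst lborel_integral_real_affine[where c = 1 and t = y])
       (auto intro!: Bochner_Integration.integral_cong simp: indicator_def)
  also have "\<dots> = (LINT x:{0..}|lborel. exp (- (y\<^sup>2 / 2)) * (x ^ 0 * exp (- (y * x) - x\<^sup>2 / 2)))"
    by (intro set_lebesgue_integral_cong)
       (auto simp: mult_exp_exp power2_eq_square field_simps)
  also have "\<dots> = exp (- (y\<^sup>2 / 2)) * gauss_moment 0 y"
    by (simp only: set_integral_mult_right gauss_moment_def)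
  finally have tail: "(LINT s:{y..}|lborel. ?g s) = exp (- (y\<^sup>2 / 2)) * gauss_moment 0 y" .
  have "(LINT s:{0..<y} \<union> {y..}|lborel. ?g s) = (LINT s:{0..<y}|lborel. ?g s) + (LINT s:{y..}|lborel. ?g s)"
    by (intro set_integral_Un set_integrable_subset[OF int]) (use assms in auto)
  moreover have "{0..<y} \<union> {y..} = {0..}"
    using assms by auto
  moreover have "(LINT s:{0..<y}|lborel. ?g s) = (LINT s:{0..y}|lborel. ?g s)"
    using AE_lborel_singleton[of y]
    by (intro set_integral_cong_set) (auto simp: set_borel_measurable_def elim!: eventually_mono)
  moreover have "(LINT s:{0..y}|lborel. ?g s) = integral {0..y} ?g"
    by (rule set_borel_integral_eq_integral(2)) (rule set_integrable_subset[OF int], auto)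
  ultimately have "gauss_moment 0 0 = integral {0..y} ?g + exp (- (y\<^sup>2 / 2)) * gauss_moment 0 y"
    using tail by (simp add: gauss_moment_def)
  then show ?thesis
    by (simp add: exp_minus field_simps)
qed

lemma mills_DERIV:
  assumes "y > 0"
  shows "(gauss_moment 0 has_real_derivative y * gauss_moment 0 y - 1) (at y)"
proof -
  let ?g = "\<lambda>s::real. exp (- (s\<^sup>2 / 2))"
  \<comment> \<open>The right end \<open>y + 1\<close> makes y an interior point, so that the
    derivative within the interval becomes a two-sided one.\<close>
  have "((\<lambda>u. integral {0..u} ?g) has_real_derivative ?g y) (at y within {0..y + 1})"
    by (rule integral_has_real_derivative) (use assms in \<open>auto intro!: continuous_intros\<close>)
  then have I: "((\<lambda>u. integral {0..u} ?g) has_real_derivative ?g y) (at y)"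
    using assms by (simp add: at_within_Icc_at)
  have "((\<lambda>y. exp (y\<^sup>2 / 2)) has_real_derivative y * exp (y\<^sup>2 / 2)) (at y)"
    by (auto intro!: derivative_eq_intros)
  moreover have "((\<lambda>y. gauss_moment 0 0 - integral {0..y} ?g) has_real_derivative 0 - ?g y) (at y)"
    by (intro DERIV_diff I DERIV_const)
  ultimately have "((\<lambda>y. exp (y\<^sup>2 / 2) * (gauss_moment 0 0 - integral {0..y} ?g)) has_real_derivative
      y * exp (y\<^sup>2 / 2) * (gauss_moment 0 0 - integral {0..y} ?g) + (0 - ?g y) * exp (y\<^sup>2 / 2)) (at y)"
    by (rule DERIV_mult)
  moreover have "y * exp (y\<^sup>2 / 2) * (gauss_moment 0 0 - integral {0..y} ?g) = y * gauss_moment 0 y"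
    using mills_tail[of y] assms by simp
  moreover have "(0 - ?g y) * exp (y\<^sup>2 / 2) = - 1"
    by (simp add: mult_exp_exp)
  ultimately have "((\<lambda>y. exp (y\<^sup>2 / 2) * (gauss_moment 0 0 - integral {0..y} ?g)) has_real_derivative
          y * gauss_moment 0 y - 1) (at y)"
    by simp
  then show ?thesis
    by (rule has_field_derivative_transform_within_open[where S = "{0<..}"])
       (use assms in \<open>auto intro!: mills_tail[symmetric]\<close>)
qed

lemma gauss_moment_measurable [measurable]: "gauss_moment k \<in> borel_measurable borel"
  unfolding gauss_moment_def[abs_def] set_lebesgue_integral_def by measurable

lemma mills_continuous: "continuous_on {0<..} (gauss_moment 0)"
  by (intro continuous_at_imp_continuous_on ballI DERIV_isCont[OF mills_DERIV]) simp

lemma mills_bounds: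
  assumes "y > 0" "x \<ge> 0"
  shows "0 < gauss_moment 0 (y + x)" "y * gauss_moment 0 (y + x) \<le> 1" "(y + x) * gauss_moment 0 (y + x) \<le> 1"
proof -
  show "0 < gauss_moment 0 (y + x)" using assms by (intro gauss_moment_pos) auto
  then have "x * gauss_moment 0 (y + x) \<ge> 0" using assms by simp
  moreover have "(y + x) * gauss_moment 0 (y + x) < 1" using assms by (intro mills_lt_inverse) auto
  ultimately show "y * gauss_moment 0 (y + x) \<le> 1" "(y + x) * gauss_moment 0 (y + x) \<le> 1"
    by (auto simp: algebra_simps)
qed

text \<open>The integral is E[m(\<rho> + \<tau>)] and its value is \<open>fwd_a \<rho>\<close> /
  \<rho>; it enters through the Rayleigh mean of the right half of the solution.\<close>

lemma rayleigh_mean_mills: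
  assumes "\<rho> > 0"
  shows "set_integrable lborel {0..} (\<lambda>x. x * gauss_moment 0 (\<rho> + x) * exp (- (x\<^sup>2 / 2)))"
    and "(LINT x:{0..}|lborel. x * gauss_moment 0 (\<rho> + x) * exp (- (x\<^sup>2 / 2))) = (gauss_moment 0 \<rho> - gauss_moment 0 0) / \<rho>\<^sup>2 + 1 / \<rho>"
proof -
  let ?e = "\<lambda>x::real. exp (- (x\<^sup>2 / 2))"
  let ?w = "\<lambda>x. gauss_moment 0 (\<rho> + x)"
  have w: "\<bar>?w x\<bar> \<le> 1 / \<rho>" if "x \<ge> 0" for x
    using mills_bounds[OF assms that] assms by (simp add: field_simps)
  show i1: "set_integrable lborel {0..} (\<lambda>x. x * ?w x * ?e x)"
  proof (rule gauss_dominated_integrable[where C = "1 / \<rho>" and k = 1])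
    show "\<bar>x * ?w x\<bar> \<le> 1 / \<rho> * x ^ 1" if "x \<ge> 0" for x
      using mult_left_mono[OF w[OF that] that] that by (simp add: abs_mult)
  qed measurable
  have i: "set_integrable lborel {0..} (\<lambda>x. 1 / \<rho> * (x ^ 1 * ?e x))"
    "set_integrable lborel {0..} (\<lambda>x. 1 / \<rho>\<^sup>2 * (x ^ 0 * ?e x))"
    by (intro set_integrable_mult_right gauss_halfline_integrable)+
  have gm0: "gauss_moment k 0 = (LINT x:{0..}|lborel. x ^ k * ?e x)" for k
    by (simp add: gauss_moment_def)
  let ?d = "\<lambda>x. x * ?w x * ?e x - 1 / \<rho> * (x ^ 1 * ?e x) + 1 / \<rho>\<^sup>2 * (x ^ 0 * ?e x)"
  \<comment> \<open>of the ansatz \<open>(\<alpha> + \<beta> x) w e\<close>, the choice whose derivative contains \<open>x w e\<close> but no term \<open>w e\<close>\<close>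
  let ?G = "\<lambda>x. (x / \<rho> - 1 / \<rho>\<^sup>2) * ?w x * ?e x"
  have "(LINT x:{0..}|lborel. ?d x) = 0 - ?G 0"
  proof (rule set_integral_FTC_atLeast)
    show "set_integrable lborel {0..} ?d"
      by (intro set_integral_diff(1) set_integral_add(1) i i1)
    show "(?G has_real_derivative ?d x) (at x)" if "x \<ge> 0" for x
    proof -
      have "(?w has_real_derivative (\<rho> + x) * ?w x - 1) (at x)"
        using DERIV_shift[of "gauss_moment 0" "(\<rho> + x) * ?w x - 1" x \<rho>] mills_DERIV[of "\<rho> + x"] assms that
        by (simp add: add.commute)
      moreover have "(?e has_real_derivative - x * ?e x) (at x)"
        by (auto intro!: derivative_eq_intros)
      moreover have "((\<lambda>x. x / \<rho> - 1 / \<rho>\<^sup>2) has_real_derivative 1 / \<rho>) (at x)"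
        using assms by (auto intro!: derivative_eq_intros)
      ultimately have "(?G has_real_derivative
          (1 / \<rho> * ?w x + ((\<rho> + x) * ?w x - 1) * (x / \<rho> - 1 / \<rho>\<^sup>2)) * ?e x +
          - x * ?e x * ((x / \<rho> - 1 / \<rho>\<^sup>2) * ?w x)) (at x)"
        by (intro DERIV_mult)
      moreover have "(1 / \<rho> * w + ((\<rho> + x) * w - 1) * (x / \<rho> - 1 / \<rho>\<^sup>2)) * e +
          - x * e * ((x / \<rho> - 1 / \<rho>\<^sup>2) * w) = x * w * e - 1 / \<rho> * (x ^ 1 * e) + 1 / \<rho>\<^sup>2 * (x ^ 0 * e)"
        for w e :: real
        using assms by (simp add: field_simps power2_eq_square)
      ultimately show ?thesis by simp
    qed
    show "continuous_on {0..} ?d"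
      by (intro continuous_intros continuous_on_compose2[OF mills_continuous]) (use assms in auto)
    show "(?G \<longlongrightarrow> 0) at_top"
    proof (rule Lim_null_comparison)
      show "((\<lambda>x. \<bar>x / \<rho> - 1 / \<rho>\<^sup>2\<bar> * (1 / \<rho>) * ?e x) \<longlongrightarrow> 0) at_top"
        using assms by real_asymp
      show "\<forall>\<^sub>F x in at_top. norm (?G x) \<le> \<bar>x / \<rho> - 1 / \<rho>\<^sup>2\<bar> * (1 / \<rho>) * ?e x"
        using eventually_ge_at_top[of 0]
      proof eventually_elim
        case (elim x)
        have "norm (?G x) = \<bar>x / \<rho> - 1 / \<rho>\<^sup>2\<bar> * \<bar>?w x\<bar> * ?e x"
          by (simp only: real_norm_def abs_mult abs_exp_cancel)
        then show ?case
          using mult_right_mono[OF mult_left_mono[OF w[OF elim] abs_ge_zero] exp_ge_zero] by metis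
      qed
    qed
  qed
  moreover have "(LINT x:{0..}|lborel. ?d x) = (LINT x:{0..}|lborel. x * ?w x * ?e x) - 1 / \<rho> * gauss_moment 1 0 + 1 / \<rho>\<^sup>2 * gauss_moment 0 0"
    by (simp only: set_integral_add(2)[OF set_integral_diff(1)[OF i1 i(1)] i(2)]
        set_integral_diff(2)[OF i1 i(1)] set_integral_mult_right gm0)
  ultimately show "(LINT x:{0..}|lborel. x * gauss_moment 0 (\<rho> + x) * ?e x) = (gauss_moment 0 \<rho> - gauss_moment 0 0) / \<rho>\<^sup>2 + 1 / \<rho>"
    using gauss_moment_1[of 0] by (simp add: diff_divide_distrib)
qed

subsection \<open>Monotonicity of the closed form\<close>

text \<open>\<open>fwd_a \<rho>\<close> and \<open>fwd_c \<rho>\<close> are \<open>a\<close> and \<open>a / (p (2 - p))\<close>; the latter is \<open>1 + E[f (- \<tau>)]\<close> for the solution \<open>f\<close> of the resolvent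
  equation.\<close>

definition fwd_a :: "real \<Rightarrow> real" where
  "fwd_a \<rho> = 1 + (gauss_moment 0 \<rho> - gauss_moment 0 0) / \<rho>"

definition fwd_c :: "real \<Rightarrow> real" where
  "fwd_c \<rho> = fwd_a \<rho> / (\<rho> * gauss_moment 0 \<rho> * (2 - \<rho> * gauss_moment 0 \<rho>))"

lemma fwd_DERIV:
  assumes "\<rho> > 0"
  shows "\<exists>D>0. ((\<lambda>\<rho>. fwd_c \<rho> * fwd_a \<rho>) has_real_derivative D) (at \<rho>)"
proof -
  \<comment> \<open>\<open>gauss_moment 2\<close> is the derivative of p because p = 1 -
    \<open>gauss_moment 1\<close>; the formula for \<open>a'\<close> is that of the derivative of an
    average.\<close>
  define p p' a a' where "p = \<rho> * gauss_moment 0 \<rho>" "p' = gauss_moment 2 \<rho>" "a = fwd_a \<rho>" "a' = (p - a) / \<rho>"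
  have gm2: "gauss_moment 2 \<rho> = gauss_moment 0 \<rho> - \<rho> * (1 - \<rho> * gauss_moment 0 \<rho>)"
    using gauss_moment_1[of \<rho>] gauss_moment_2[of \<rho>] assms by simp
  have p01: "0 < p" "p < 1"
    using assms gauss_moment_pos[of \<rho> 0] mills_lt_inverse[of \<rho>] by (auto simp: p_p'_a_a'_def)
  have p': "p' > 0"
    using assms gauss_moment_pos[of \<rho> 2] by (simp add: p_p'_a_a'_def)
  have a0: "a > 0"
    using mills_drop_lt[OF assms] assms by (simp add: p_p'_a_a'_def fwd_a_def field_simps)
  \<comment> \<open>Here \<rho> (p - a) equals m(0) - m(\<rho>) - \<rho>
    \<open>gauss_moment 1 \<rho>\<close>, which is the quantity that
    \<open>mills_second_order\<close> bounds below.\<close>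
  have a': "p' / 2 \<le> a'"
  proof -
    have "\<rho> * a = \<rho> + gauss_moment 0 \<rho> - gauss_moment 0 0"
      using assms by (simp add: p_p'_a_a'_def fwd_a_def distrib_left)
    then have "\<rho> * (p - a) = \<rho> * (\<rho> * gauss_moment 0 \<rho>) - \<rho> - gauss_moment 0 \<rho> + gauss_moment 0 0"
      by (simp add: p_p'_a_a'_def right_diff_distrib)
    moreover have "gauss_moment 0 \<rho> + \<rho> * (1 - \<rho> * gauss_moment 0 \<rho>) + \<rho>\<^sup>2 / 2 * p' \<le> gauss_moment 0 0"
      using mills_second_order[OF assms] gauss_moment_1[of \<rho>] assms by (simp add: p_p'_a_a'_def)
    ultimately have "\<rho> * (\<rho> * p' / 2) \<le> \<rho> * (p - a)"
      by (simp add: power2_eq_square right_diff_distrib)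
    then have "\<rho> * p' / 2 \<le> p - a"
      using assms by simp
    then show ?thesis
      using assms by (simp add: p_p'_a_a'_def(4) pos_le_divide_eq mult.commute)
  qed
  have "a' * \<rho> > 0"
    using a' p' assms by simp
  then have "a < p"
    using assms by (simp add: p_p'_a_a'_def(4))
  define D where "D = ((a' * a + a' * a) * (p * (2 - p)) - a * a * (p' * (2 - p) + (0 - p') * p)) / (p * (2 - p) * (p * (2 - p)))"
  have gauss_moment': "(gauss_moment 0 has_real_derivative \<rho> * gauss_moment 0 \<rho> - 1) (at \<rho>)"
    by (rule mills_DERIV[OF assms])
  have "((\<lambda>\<rho>. \<rho> * gauss_moment 0 \<rho>) has_real_derivative 1 * gauss_moment 0 \<rho> + (\<rho> * gauss_moment 0 \<rho> - 1) * \<rho>) (at \<rho>)"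
    by (intro DERIV_mult gauss_moment' DERIV_ident)
  moreover have "1 * gauss_moment 0 \<rho> + (\<rho> * gauss_moment 0 \<rho> - 1) * \<rho> = p'"
    unfolding p_p'_a_a'_def(2) gm2 by (simp add: algebra_simps)
  ultimately have Dp: "((\<lambda>\<rho>. \<rho> * gauss_moment 0 \<rho>) has_real_derivative p') (at \<rho>)"
    by simp
  have "(fwd_a has_real_derivative
      0 + ((\<rho> * gauss_moment 0 \<rho> - 1 - 0) * \<rho> - (gauss_moment 0 \<rho> - gauss_moment 0 0) * 1) / (\<rho> * \<rho>)) (at \<rho>)"
    unfolding fwd_a_def[abs_def] using assms
    by (intro DERIV_add DERIV_const DERIV_divide DERIV_diff gauss_moment' DERIV_ident) simp
  moreover have "0 + ((\<rho> * gauss_moment 0 \<rho> - 1 - 0) * \<rho> - (gauss_moment 0 \<rho> - gauss_moment 0 0) * 1) / (\<rho> * \<rho>) = a'"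
    unfolding p_p'_a_a'_def fwd_a_def using assms by (simp add: field_simps)
  ultimately have Da: "(fwd_a has_real_derivative a') (at \<rho>)"
    by simp
  have D2: "((\<lambda>\<rho>. \<rho> * gauss_moment 0 \<rho> * (2 - \<rho> * gauss_moment 0 \<rho>)) has_real_derivative
      p' * (2 - \<rho> * gauss_moment 0 \<rho>) + (0 - p') * (\<rho> * gauss_moment 0 \<rho>)) (at \<rho>)"
    by (intro DERIV_mult DERIV_diff DERIV_const Dp)
  have "((\<lambda>\<rho>. fwd_a \<rho> * fwd_a \<rho> / (\<rho> * gauss_moment 0 \<rho> * (2 - \<rho> * gauss_moment 0 \<rho>))) has_real_derivative
      ((a' * fwd_a \<rho> + a' * fwd_a \<rho>) * (\<rho> * gauss_moment 0 \<rho> * (2 - \<rho> * gauss_moment 0 \<rho>)) -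
        fwd_a \<rho> * fwd_a \<rho> * (p' * (2 - \<rho> * gauss_moment 0 \<rho>) + (0 - p') * (\<rho> * gauss_moment 0 \<rho>))) /
      ((\<rho> * gauss_moment 0 \<rho> * (2 - \<rho> * gauss_moment 0 \<rho>)) * (\<rho> * gauss_moment 0 \<rho> * (2 - \<rho> * gauss_moment 0 \<rho>)))) (at \<rho>)"
    by (rule DERIV_divide[OF DERIV_mult[OF Da Da] D2])
       (use p01 in \<open>simp add: p_p'_a_a'_def(1)[symmetric]\<close>)
  then have "((\<lambda>\<rho>. fwd_a \<rho> * fwd_a \<rho> / (\<rho> * gauss_moment 0 \<rho> * (2 - \<rho> * gauss_moment 0 \<rho>))) has_real_derivative D) (at \<rho>)"
    unfolding D_def p_p'_a_a'_def(1)[symmetric] p_p'_a_a'_def(3)[symmetric] .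
  moreover have "(\<lambda>\<rho>. fwd_c \<rho> * fwd_a \<rho>) = (\<lambda>\<rho>. fwd_a \<rho> * fwd_a \<rho> / (\<rho> * gauss_moment 0 \<rho> * (2 - \<rho> * gauss_moment 0 \<rho>)))"
    by (auto simp: fwd_c_def)
  moreover have "D > 0"
  proof -
    have "a * (1 - p) < p * (1 - p)"
      using \<open>a < p\<close> p01 by simp
    also have "\<dots> < p * (2 - p) / 2"
      using p01 by (simp add: field_simps)
    finally have "p' * (a * (1 - p)) < p' * (p * (2 - p) / 2)"
      using p' by (rule mult_strict_left_mono)
    also have "\<dots> \<le> a' * (p * (2 - p))"
      using mult_right_mono[OF a', of "p * (2 - p)"] p01 by simp
    finally have "2 * a * (a' * (p * (2 - p)) - p' * (a * (1 - p))) > 0"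
      using a0 by simp
    also have "2 * a * (a' * (p * (2 - p)) - p' * (a * (1 - p))) =
        (a' * a + a' * a) * (p * (2 - p)) - a * a * (p' * (2 - p) + (0 - p') * p)"
      by (simp add: algebra_simps)
    finally show ?thesis
      using p01 by (simp add: D_def)
  qed
  ultimately show ?thesis by auto
qed

subsection \<open>Measurability, Laplace transforms and local martingales\<close>

text \<open>Joint measurability is what permits Fubini between time and expectation.
  \<open>max t 0\<close> extends the process to the whole line, on which Lebesgue measure lives. The
  sampled process takes countably many times, hence is measurable; samples lie strictly to the right
  because \<open>at_right t\<close> excludes t.\<close>

lemma borel_measurable_right_continuous:
  fixes X :: "real \<Rightarrow> 'a \<Rightarrow> real"
  assumes [measurable]: "\<And>t. t \<ge> 0 \<Longrightarrow> X t \<in> borel_measurable M"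
    and cont: "\<And>\<omega> t. \<omega> \<in> space M \<Longrightarrow> t \<ge> 0 \<Longrightarrow> ((\<lambda>s. X s \<omega>) \<longlongrightarrow> X t \<omega>) (at_right t)"
  shows "(\<lambda>(t, \<omega>). X (max t 0) \<omega>) \<in> borel_measurable (borel \<Otimes>\<^sub>M M)"
proof -
  \<comment> \<open>sampling times on a grid of mesh \<open>1 / Suc n\<close> that approach \<open>max t 0\<close> strictly from the right\<close>
  define g :: "nat \<Rightarrow> real \<Rightarrow> real"
    where "g n t = (real (nat \<lfloor>max t 0 * Suc n\<rfloor>) + 1) / Suc n" for n t
  have g: "filterlim (\<lambda>n. g n t) (at_right (max t 0)) sequentially" for t
  proof -
    have bnd: "max t 0 < g n t \<and> g n t \<le> max t 0 + 1 / Suc n" for n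
    proof -
      obtain y where y: "y = max t 0" "y \<ge> 0" by auto
      have "real (nat \<lfloor>y * Suc n\<rfloor>) = of_int \<lfloor>y * Suc n\<rfloor>"
        using y(2) by simp
      moreover have "y * Suc n < of_int \<lfloor>y * Suc n\<rfloor> + 1" "of_int \<lfloor>y * Suc n\<rfloor> \<le> y * Suc n"
        by linarith+
      ultimately have "y < (real (nat \<lfloor>y * Suc n\<rfloor>) + 1) / Suc n"
          "(real (nat \<lfloor>y * Suc n\<rfloor>) + 1) / Suc n \<le> y + 1 / Suc n"
        by (simp_all add: pos_less_divide_eq pos_divide_le_eq distrib_right del: of_nat_Suc)
      then show ?thesis
        by (simp only: g_def flip: y(1))
    qed
    have lim: "(\<lambda>n. max t 0 + 1 / Suc n) \<longlonglongrightarrow> max t 0 + 0"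
      by (intro tendsto_intros lim_1_over_n[THEN LIMSEQ_Suc])
    have "(\<lambda>n. g n t) \<longlonglongrightarrow> max t 0"
    proof (rule tendsto_sandwich)
      show "(\<lambda>_. max t 0) \<longlonglongrightarrow> max t 0" by simp
      show "(\<lambda>n. max t 0 + 1 / Suc n) \<longlonglongrightarrow> max t 0" using lim by simp
    qed (use bnd in \<open>simp_all add: less_imp_le\<close>)
    then show ?thesis
      unfolding filterlim_at
      by (intro conjI always_eventually allI) (use bnd in \<open>simp_all add: less_imp_neq[THEN not_sym]\<close>)
  qed
  show ?thesis
  proof (rule borel_measurable_LIMSEQ_real[where u = "\<lambda>n p. X (g n (fst p)) (snd p)"])
    show "(\<lambda>p. X (g n (fst p)) (snd p)) \<in> borel_measurable (borel \<Otimes>\<^sub>M M)" for n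
      unfolding g_def
    proof (rule measurable_compose_countable[where f = "\<lambda>i p. X ((real i + 1) / real (Suc n)) (snd p)"])
      show "(\<lambda>p. X ((real i + 1) / real (Suc n)) (snd p)) \<in> borel_measurable (borel \<Otimes>\<^sub>M M)" for i
        by (rule measurable_compose[OF measurable_snd assms(1)]) simp
      show "(\<lambda>p. nat \<lfloor>max (fst p) 0 * real (Suc n)\<rfloor>) \<in> borel \<Otimes>\<^sub>M M \<rightarrow>\<^sub>M count_space UNIV"
        by measurable
    qed
    show "(\<lambda>n. X (g n (fst p)) (snd p)) \<longlonglongrightarrow> (case p of (t, \<omega>) \<Rightarrow> X (max t 0) \<omega>)"
      if "p \<in> space (borel \<Otimes>\<^sub>M M)" for p
    proof -
      have "snd p \<in> space M"
        using that by (auto simp: space_pair_measure)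
      then show ?thesis
        using filterlim_compose[OF cont g, of "snd p" "fst p"] by (simp add: split_beta)
    qed
  qed
qed

text \<open>By local finiteness the next jump comes strictly after t, and until then the path is the
  flow started at \<open>x t\<close>.\<close>

lemma piecewise_deterministic_path_right_continuous:
  assumes path: "piecewise_deterministic_path \<phi> x" and "t \<ge> 0"
    and flow: "((\<lambda>s. \<phi> (s - t) (x t)) \<longlongrightarrow> x t) (at_right t)"
  shows "(x \<longlongrightarrow> x t) (at_right t)"
proof -
  obtain J where J: "finite (J \<inter> {..t + 1})"
    "\<And>s. t \<le> s \<Longrightarrow> J \<inter> {t<..s} = {} \<Longrightarrow> x s = \<phi> (s - t) (x t)"
    using path \<open>t \<ge> 0\<close> unfolding piecewise_deterministic_path_def by blast
  \<comment> \<open>The cap \<open>t + 1\<close> keeps the set nonempty when no jump occurs soon,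
    and restricting to \<open>{..t + 1}\<close> keeps it finite.\<close>
  define m where "m = Min (insert (t + 1) (J \<inter> {..t + 1} \<inter> {t<..}))"
  have m: "t < m" "\<And>u. u \<in> J \<Longrightarrow> t < u \<Longrightarrow> m \<le> u"
  proof -
    show "t < m" unfolding m_def using J(1) by (subst Min_gr_iff) auto
    show "m \<le> u" if "u \<in> J" "t < u" for u
    proof (cases "u \<le> t + 1")
      case True
      then show ?thesis unfolding m_def using J(1) that by (intro Min_le) auto
    next
      case False
      have "m \<le> t + 1" unfolding m_def using J(1) by (intro Min_le) auto
      then show ?thesis using False by simp
    qed
  qed
  have "\<forall>\<^sub>F s in at_right t. \<phi> (s - t) (x t) = x s"
    unfolding eventually_at_right_field
  proof (intro exI[of _ m] conjI allI impI m(1))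
    fix s assume s: "t < s" "s < m"
    then have "J \<inter> {t<..s} = {}" using m(2) by force
    then show "\<phi> (s - t) (x t) = x s" using J(2)[of s] s by simp
  qed
  with flow show ?thesis by (rule Lim_transform_eventually)
qed

section \<open>Laplace transforms in time\<close>

lemma set_integrable_power_exp:
  fixes \<rho> :: real
  assumes "\<rho> > 0"
  shows "set_integrable lborel {0..} (\<lambda>t. t ^ k * exp (- \<rho> * t))"
proof -
  have "integrable lborel (\<lambda>x::real. x ^ k * exp (- x) * indicator {0..} x)"
  proof (rule integrable_cong_AE_imp)
    show "integrable lborel (\<lambda>x::real. x ^ k * exp (- x) * indicator {0<..} x)"
      using has_bochner_integral_I0i_power_exp_m[of k] by (rule integrable.intros)
    show "AE x::real in lborel. x ^ k * exp (- x) * indicator {0<..} x = x ^ k * exp (- x) * indicator {0..} x"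
      using AE_lborel_singleton[of 0] by eventually_elim (auto simp: indicator_def)
  qed measurable
  then have "integrable lborel (\<lambda>x. 1 / \<rho> ^ k * ((0 + \<rho> * x) ^ k * exp (- (0 + \<rho> * x)) * indicator {0..} (0 + \<rho> * x)))"
    using assms by (intro integrable_mult_right lborel_integrable_real_affine) auto
  also have "(\<lambda>x. 1 / \<rho> ^ k * ((0 + \<rho> * x) ^ k * exp (- (0 + \<rho> * x)) * indicator {0..} (0 + \<rho> * x))) =
      (\<lambda>t. indicator {0..} t *\<^sub>R (t ^ k * exp (- \<rho> * t)))"
    using assms by (auto simp: fun_eq_iff indicator_def power_mult_distrib zero_le_mult_iff)
  finally show ?thesis
    unfolding set_integrable_def .
qed

lemma set_integral_exp:
  fixes \<rho> :: real
  assumes "\<rho> > 0" "s \<ge> 0"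
  shows "(LINT t:{s..}|lborel. exp (- \<rho> * t)) = exp (- \<rho> * s) / \<rho>"
proof -
  have "(LINT t:{s..}|lborel. exp (- \<rho> * t)) = 0 - (- exp (- \<rho> * s) / \<rho>)"
  proof (rule set_integral_FTC_atLeast)
    show "set_integrable lborel {s..} (\<lambda>t. exp (- \<rho> * t))"
      using set_integrable_subset[OF set_integrable_power_exp[OF assms(1), of 0], of "{s..}"] assms
      by simp
    show "((\<lambda>t. - exp (- \<rho> * t) / \<rho>) has_real_derivative exp (- \<rho> * t)) (at t)" for t
      using assms by (auto intro!: derivative_eq_intros)
    show "continuous_on {s..} (\<lambda>t. exp (- \<rho> * t))"
      by (intro continuous_intros)
    show "((\<lambda>t. - exp (- \<rho> * t) / \<rho>) \<longlongrightarrow> 0) at_top"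
      using assms by real_asymp
  qed
  then show ?thesis by simp
qed

text \<open>Fubini on the triangle 0 \<le> s \<le> t: integrating exp(- \<rho> t) over t \<ge> s
  gives exp(- \<rho> s) / \<rho>. The function C t exp(- \<rho> t) dominates the inner
  integrals.\<close>

lemma laplace_primitive:
  fixes v :: "real \<Rightarrow> real"
  assumes [measurable]: "v \<in> borel_measurable borel" and C: "\<And>s. s \<ge> 0 \<Longrightarrow> \<bar>v s\<bar> \<le> C" and "\<rho> > 0"
  shows "set_integrable lborel {0..} (\<lambda>t. exp (- \<rho> * t) * (LINT s:{0..t}|lborel. v s))"
    and "(LINT t:{0..}|lborel. exp (- \<rho> * t) * (LINT s:{0..t}|lborel. v s)) =
      (LINT s:{0..}|lborel. exp (- \<rho> * s) * v s) / \<rho>"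
proof -
  define h where "h t s = indicator {0..} t * exp (- \<rho> * t) * (indicator {0..t} s * v s)" for t s :: real
  have h_eq: "case_prod h = (\<lambda>p. if 0 \<le> fst p \<and> 0 \<le> snd p \<and> snd p \<le> fst p then exp (- \<rho> * fst p) * v (snd p) else 0)"
    by (auto simp: h_def fun_eq_iff indicator_def)
  have "case_prod h \<in> borel_measurable (borel \<Otimes>\<^sub>M borel)"
    unfolding h_eq by measurable
  then have [measurable]: "case_prod h \<in> borel_measurable (lborel \<Otimes>\<^sub>M lborel)"
    by (subst measurable_cong_sets[OF sets_pair_measure_cong[OF sets_lborel sets_lborel] refl])
  have vi: "integrable lborel (\<lambda>s. indicator {0..t} s * v s)" for t :: real
    by (rule integrableI_bounded_set[where A = "{0..t}" and B = C])
       (use C in \<open>auto intro!: AE_I2 simp: indicator_def emeasure_lborel_Icc_eq\<close>)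
  have exp_int: "set_integrable lborel {0..} (\<lambda>t. t * exp (- \<rho> * t))"
    using set_integrable_power_exp[OF \<open>\<rho> > 0\<close>, of 1] by simp
  have hi: "integrable (lborel \<Otimes>\<^sub>M lborel) (case_prod h)"
  proof (rule lborel_pair.Fubini_integrable)
    show "AE t in lborel. integrable lborel (\<lambda>s. case (t, s) of (x, xa) \<Rightarrow> h x xa)"
      unfolding h_def case_prod_conv by (intro AE_I2 integrable_mult_right vi)
    show "integrable lborel (\<lambda>t. \<integral>s. norm (case (t, s) of (x, xa) \<Rightarrow> h x xa) \<partial>lborel)"
    proof (rule Bochner_Integration.integrable_bound)
      show "integrable lborel (\<lambda>t. C * (indicator {0..} t *\<^sub>R (t * exp (- \<rho> * t))))"
        using exp_int unfolding set_integrable_def by (intro integrable_mult_right)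
      show "AE t in lborel. norm (\<integral>s. norm (case (t, s) of (x, xa) \<Rightarrow> h x xa) \<partial>lborel)
          \<le> norm (C * (indicator {0..} t *\<^sub>R (t * exp (- \<rho> * t))))"
      proof (rule AE_I2)
        fix t :: real
        have "(\<integral>s. norm (h t s) \<partial>lborel) \<le> (\<integral>s. indicator {0..} t * (exp (- \<rho> * t) * C) * indicator {0..t} s \<partial>lborel)"
        proof (rule integral_mono)
          show "integrable lborel (\<lambda>s. norm (h t s))"
            unfolding h_def by (intro integrable_norm integrable_mult_right vi)
          show "norm (h t s) \<le> indicator {0..} t * (exp (- \<rho> * t) * C) * indicator {0..t} s" for s
            using C by (auto simp: h_def indicator_def abs_mult)
        qed (intro integrable_mult_right integrable_real_indicator, auto simp: emeasure_lborel_Icc_eq)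
        also have "\<dots> = C * (indicator {0..} t *\<^sub>R (t * exp (- \<rho> * t)))"
          by (cases "t \<ge> 0") simp_all
        finally show "norm (\<integral>s. norm (case (t, s) of (x, xa) \<Rightarrow> h x xa) \<partial>lborel)
          \<le> norm (C * (indicator {0..} t *\<^sub>R (t * exp (- \<rho> * t))))"
          by (simp add: abs_of_nonneg)
      qed
    qed measurable
  qed measurable
  have inner: "(\<integral>s. h t s \<partial>lborel) = indicator {0..} t *\<^sub>R (exp (- \<rho> * t) * (LINT s:{0..t}|lborel. v s))" for t
    by (simp add: h_def set_lebesgue_integral_def mult.assoc)
  show "set_integrable lborel {0..} (\<lambda>t. exp (- \<rho> * t) * (LINT s:{0..t}|lborel. v s))"
    using lborel_pair.integrable_fst[OF hi] by (simp add: inner set_integrable_def)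
  have tail: "(LINT t:{s..}|lborel. exp (- \<rho> * t)) = exp (- \<rho> * s) / \<rho>" if "s \<ge> 0" for s
    by (rule set_integral_exp[OF \<open>\<rho> > 0\<close> that])
  have outer: "(\<integral>t. h t s \<partial>lborel) = (indicator {0..} s *\<^sub>R (exp (- \<rho> * s) * v s)) / \<rho>" for s
  proof -
    have "h t s = (indicator {0..} s * v s) * (indicator {s..} t *\<^sub>R exp (- \<rho> * t))" for t
      by (auto simp: h_def indicator_def)
    then have "(\<integral>t. h t s \<partial>lborel) = indicator {0..} s * v s * (LINT t:{s..}|lborel. exp (- \<rho> * t))"
      by (simp add: set_lebesgue_integral_def)
    then show ?thesis using tail[of s] by (cases "s \<ge> 0") simp_all
  qed
  have "(\<integral>t. (\<integral>s. h t s \<partial>lborel) \<partial>lborel) = (\<integral>s. (\<integral>t. h t s \<partial>lborel) \<partial>lborel)"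
    using lborel_pair.Fubini_integral[OF hi] by simp
  then show "(LINT t:{0..}|lborel. exp (- \<rho> * t) * (LINT s:{0..t}|lborel. v s)) =
      (LINT s:{0..}|lborel. exp (- \<rho> * s) * v s) / \<rho>"
    unfolding inner outer by (simp add: set_lebesgue_integral_def)
qed

text \<open>Each stopped process has conditional expectation Y_0 = 0 given \<open>F 0\<close>, and
  dominated convergence removes the stopping. The bound concerns the product with \<open>X\<close>,
  because \<open>X\<close> will be the unbounded Gaussian initial state, and it covers all s in
  [0, t] because stopping may freeze the process at any of these times.\<close>

lemma (in prob_space) local_martingale_orthogonal:
  assumes Y: "local_martingale M F Y" and sub: "subalgebra M (F 0)"
    and X [measurable]: "X \<in> borel_measurable (F 0)" and "t \<ge> 0"
    and Y0: "\<And>\<omega>. \<omega> \<in> space M \<Longrightarrow> Y 0 \<omega> = 0"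
    and meas [measurable]: "Y t \<in> borel_measurable M"
    and B: "integrable M B" "AE \<omega> in M. \<forall>s\<in>{0..t}. \<bar>X \<omega> * Y s \<omega>\<bar> \<le> B \<omega>"
  shows "expectation (\<lambda>\<omega>. X \<omega> * Y t \<omega>) = 0"
proof -
  interpret finite_measure_subalgebra M "F 0"
    by standard (rule sub)
  have XM [measurable]: "X \<in> borel_measurable M"
    by (rule measurable_from_subalg[OF sub X])
  obtain T where T: "\<And>n \<omega>. \<omega> \<in> space M \<Longrightarrow> 0 \<le> T n \<omega>"
    "AE \<omega> in M. filterlim (\<lambda>n. T n \<omega>) at_top sequentially"
    "\<And>n. martingale M F (\<lambda>t \<omega>. Y (min t (T n \<omega>)) \<omega>)"
    using Y unfolding local_martingale_def by auto
  let ?Y = "\<lambda>n \<omega>. Y (min t (T n \<omega>)) \<omega>"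
  have [measurable]: "?Y n \<in> borel_measurable M" for n
    using T(3)[of n] \<open>t \<ge> 0\<close> unfolding martingale_def by (blast intro: borel_measurable_integrable)
  have bnd: "AE \<omega> in M. norm (X \<omega> * ?Y n \<omega>) \<le> B \<omega>" for n
    using B(2) AE_space by eventually_elim (use T(1) \<open>t \<ge> 0\<close> in auto)
  have "expectation (\<lambda>\<omega>. X \<omega> * ?Y n \<omega>) = 0" for n
  proof -
    have "integrable M (\<lambda>\<omega>. X \<omega> * ?Y n \<omega>)"
      by (rule Bochner_Integration.integrable_bound[OF B(1)])
         (use bnd[of n] in \<open>auto elim!: eventually_mono\<close>)
    then have "expectation (\<lambda>\<omega>. X \<omega> * ?Y n \<omega>) = expectation (\<lambda>\<omega>. X \<omega> * real_cond_exp M (F 0) (?Y n) \<omega>)"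
      by (intro real_cond_exp_intg(2)[symmetric]) measurable
    also have "\<dots> = expectation (\<lambda>\<omega>. 0)"
    proof (rule integral_cong_AE)
      have "AE \<omega> in M. real_cond_exp M (F 0) (?Y n) \<omega> = Y (min 0 (T n \<omega>)) \<omega>"
        using T(3)[of n] \<open>t \<ge> 0\<close> unfolding martingale_def by auto
      then show "AE \<omega> in M. X \<omega> * real_cond_exp M (F 0) (?Y n) \<omega> = 0"
        using AE_space by eventually_elim (use T(1) Y0 in \<open>auto simp: min_def\<close>)
    qed measurable
    finally show ?thesis by simp
  qed
  moreover have "(\<lambda>n. expectation (\<lambda>\<omega>. X \<omega> * ?Y n \<omega>)) \<longlonglongrightarrow> expectation (\<lambda>\<omega>. X \<omega> * Y t \<omega>)"
  proof (rule integral_dominated_convergence[OF _ _ B(1) _ bnd])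
    show "AE \<omega> in M. (\<lambda>n. X \<omega> * ?Y n \<omega>) \<longlonglongrightarrow> X \<omega> * Y t \<omega>"
      using T(2)
    proof eventually_elim
      case (elim \<omega>)
      then have "\<forall>\<^sub>F n in sequentially. T n \<omega> \<ge> t"
        by (simp add: filterlim_at_top)
      then have "\<forall>\<^sub>F n in sequentially. X \<omega> * Y t \<omega> = X \<omega> * ?Y n \<omega>"
        by eventually_elim (simp add: min_absorb1)
      then show ?case
        by (rule Lim_transform_eventually[OF tendsto_const])
    qed
  qed measurable
  ultimately show ?thesis
    using LIMSEQ_unique[OF _ tendsto_const] by auto
qed

subsection \<open>Rayleigh averages and correlations of the process\<close>

lemma rayleigh_integral:
  assumes [measurable]: "f \<in> borel_measurable borel"
  shows "(\<integral>u. f u \<partial>rayleigh) = (LINT u:{0..}|lborel. u * f u * exp (- (u\<^sup>2 / 2)))"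
proof -
  have "(\<integral>u. f u \<partial>rayleigh) = (\<integral>x. (if x > 0 then x * exp (- x\<^sup>2 / 2) else 0) *\<^sub>R f x \<partial>lborel)"
    unfolding rayleigh_def by (intro integral_density) (auto intro!: AE_I2)
  also have "\<dots> = (LINT u:{0..}|lborel. u * f u * exp (- (u\<^sup>2 / 2)))"
    unfolding set_lebesgue_integral_def
    by (intro Bochner_Integration.integral_cong) (auto simp: indicator_def)
  finally show ?thesis .
qed

lemma sets_rayleigh [measurable_cong, simp]: "sets rayleigh = sets borel"
  by (simp add: rayleigh_def)

lemma prob_space_rayleigh: "prob_space rayleigh"
proof
  have "(\<integral>u. 1 \<partial>rayleigh) = (1::real)"
    using gauss_moment_1[of 0] by (subst rayleigh_integral) (auto simp: gauss_moment_def)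
  then have "enn2real (emeasure rayleigh (space rayleigh)) = 1"
    by (simp add: measure_def)
  then show "emeasure rayleigh (space rayleigh) = 1"
    by (cases "emeasure rayleigh (space rayleigh)") auto
qed

text \<open>On each half-line |x| times the normal density is the Rayleigh density of |x| divided by
  sqrt (2 \<pi>). This turns correlations at time 0 into the two Rayleigh means that also occur in
  the generator and the solution.\<close>

lemma gaussian_stein_rayleigh:
  assumes [measurable]: "F \<in> borel_measurable borel" and growth: "\<And>x. \<bar>F x\<bar> \<le> K * (1 + \<bar>x\<bar>)"
  shows "(\<integral>x. std_normal_density x * (x * F x) \<partial>lborel) =
    ((\<integral>u. F u \<partial>rayleigh) - (\<integral>u. F (- u) \<partial>rayleigh)) / sqrt (2 * pi)"
proof -
  let ?u = "\<lambda>x. std_normal_density x * (x * F x)"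
  have int: "integrable lborel ?u"
  proof (rule Bochner_Integration.integrable_bound)
    show "integrable lborel (\<lambda>x. K * (std_normal_density x * \<bar>x\<bar> ^ 1 + std_normal_density x * \<bar>x\<bar> ^ 2))"
      by (intro integrable_mult_right Bochner_Integration.integrable_add integrable_std_normal_moment_abs)
    show "AE x in lborel. norm (?u x) \<le> norm (K * (std_normal_density x * \<bar>x\<bar> ^ 1 + std_normal_density x * \<bar>x\<bar> ^ 2))"
    proof (rule AE_I2)
      fix x :: real
      have "norm (?u x) = std_normal_density x * \<bar>x\<bar> * \<bar>F x\<bar>"
        by (simp add: abs_mult)
      also have "\<dots> \<le> std_normal_density x * \<bar>x\<bar> * (K * (1 + \<bar>x\<bar>))"
        by (intro mult_left_mono growth) auto
      also have "\<dots> = K * (std_normal_density x * \<bar>x\<bar> ^ 1 + std_normal_density x * \<bar>x\<bar> ^ 2)"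
        by (simp add: algebra_simps power2_eq_square)
      finally show "norm (?u x) \<le> norm (K * (std_normal_density x * \<bar>x\<bar> ^ 1 + std_normal_density x * \<bar>x\<bar> ^ 2))"
        by simp
    qed
  qed measurable
  have dens: "std_normal_density x = exp (- (x\<^sup>2 / 2)) / sqrt (2 * pi)" for x
    by (simp add: std_normal_density_def)
  have i: "integrable lborel (\<lambda>x. indicator A x * ?u x)" if "A \<in> sets borel" for A
    using integrable_mult_indicator[OF _ int, of A] that by simp
  have "(\<integral>x. ?u x \<partial>lborel) = (\<integral>x. indicator {0..} x * ?u x + indicator {..<0} x * ?u x \<partial>lborel)"
    by (intro Bochner_Integration.integral_cong) (auto simp: indicator_def)
  also have "\<dots> = (\<integral>x. indicator {0..} x * ?u x \<partial>lborel) + (\<integral>x. indicator {..<0} x * ?u x \<partial>lborel)"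
    by (intro Bochner_Integration.integral_add i) auto
  also have "(\<integral>x. indicator {0..} x * ?u x \<partial>lborel) = (\<integral>u. F u \<partial>rayleigh) / sqrt (2 * pi)"
  proof -
    have "(\<integral>u. F u \<partial>rayleigh) / sqrt (2 * pi) = (LINT u:{0..}|lborel. u * F u * exp (- (u\<^sup>2 / 2))) / sqrt (2 * pi)"
      by (simp add: rayleigh_integral)
    also have "\<dots> = (LINT u:{0..}|lborel. u * F u * exp (- (u\<^sup>2 / 2)) / sqrt (2 * pi))"
      by simp
    also have "\<dots> = (\<integral>x. indicator {0..} x * ?u x \<partial>lborel)"
      unfolding set_lebesgue_integral_def by (simp add: dens mult_ac)
    finally show ?thesis ..
  qed
  also have "(\<integral>x. indicator {..<0} x * ?u x \<partial>lborel) = - (\<integral>u. F (- u) \<partial>rayleigh) / sqrt (2 * pi)"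
  proof -
    have "(\<integral>x. indicator {..<0} x * ?u x \<partial>lborel) = (\<integral>x. indicator {..<0} (- x) * ?u (- x) \<partial>lborel)"
      by (subst lborel_integral_real_affine[where c = "- 1" and t = 0]) simp_all
    \<comment> \<open>After the reflection the domain is the open half-line; adding the point 0 is
      harmless because the integrand has a factor u.\<close>
    also have "\<dots> = (LINT u:{0..}|lborel. - 1 / sqrt (2 * pi) * (u * F (- u) * exp (- (u\<^sup>2 / 2))))"
      unfolding set_lebesgue_integral_def
      by (intro Bochner_Integration.integral_cong) (auto simp: indicator_def dens)
    also have "\<dots> = - ((LINT u:{0..}|lborel. u * F (- u) * exp (- (u\<^sup>2 / 2))) / sqrt (2 * pi))"
      unfolding set_integral_mult_right by simp
    also have "\<dots> = - (\<integral>u. F (- u) \<partial>rayleigh) / sqrt (2 * pi)"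
      by (simp add: rayleigh_integral)
    finally show ?thesis .
  qed
  finally show ?thesis
    by (simp add: diff_divide_distrib)
qed

section \<open>The process and its correlations with the initial state\<close>

locale forward_process = prob_space M for M :: "'a measure" +
  fixes R :: "real \<Rightarrow> 'a \<Rightarrow> real"
  assumes R_measurable [measurable]: "\<And>t. t \<ge> 0 \<Longrightarrow> R t \<in> borel_measurable M"
    and R_path: "\<And>\<omega>. \<omega> \<in> space M \<Longrightarrow> piecewise_deterministic_path (\<lambda>t x. x + t) (\<lambda>t. R t \<omega>)"
    and R_stationary: "stationary_process M R"
    and R_0_normal: "distributed M lborel (R 0) std_normal_density"
    and R_generator: "\<And>f. f \<in> C1_bounded \<Longrightarrow> (f, L_F f) \<in> extended_generator M R"
begin

definition corr :: "(real \<Rightarrow> real) \<Rightarrow> real \<Rightarrow> real" where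
  "corr F t = expectation (\<lambda>\<omega>. R 0 \<omega> * F (R t \<omega>))"

lemma R_joint_measurable [measurable]: "(\<lambda>(t, \<omega>). R (max t 0) \<omega>) \<in> borel_measurable (borel \<Otimes>\<^sub>M M)"
proof (rule borel_measurable_right_continuous)
  fix \<omega> t assume \<omega>: "\<omega> \<in> space M" and t: "(t::real) \<ge> 0"
  have "((\<lambda>s. R t \<omega> + (s - t)) \<longlongrightarrow> R t \<omega> + (t - t)) (at_right t)"
    by (intro tendsto_intros)
  then show "((\<lambda>s. R s \<omega>) \<longlongrightarrow> R t \<omega>) (at_right t)"
    using piecewise_deterministic_path_right_continuous[OF R_path[OF \<omega>] t] by simp
qed auto

lemma distr_R:
  assumes "t \<ge> 0"
  shows "distr M borel (R t) = distr M borel (R 0)"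
proof -
  let ?P = "Pi\<^sub>M {0..} (\<lambda>_. borel :: real measure)"
  let ?X = "\<lambda>h \<omega>. \<lambda>t\<in>{0..}. R (t + h) \<omega>"
  have X: "?X h \<in> M \<rightarrow>\<^sub>M ?P" if "h \<ge> 0" for h
    by (rule measurable_restrict) (use that in auto)
  have d: "distr (distr M ?P (?X h)) borel (\<lambda>x. x 0) = distr M borel (R h)" if "h \<ge> 0" for h
    by (subst distr_distr[OF _ X[OF that]]) (auto simp: comp_def)
  have "distr M ?P (?X t) = distr M ?P (?X 0)"
    using R_stationary assms by (simp add: stationary_process_def)
  then show ?thesis
    using d[OF assms] d[of 0] by simp
qed

text \<open>Stationarity carries the second moment of the initial law to every time, which makes all
  later correlation bounds uniform in t.\<close>

lemma R_square:
  assumes "t \<ge> 0"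
  shows "integrable M (\<lambda>\<omega>. (R t \<omega>)\<^sup>2)" "expectation (\<lambda>\<omega>. (R t \<omega>)\<^sup>2) = 1"
proof -
  have 0: "has_bochner_integral lborel (\<lambda>x. std_normal_density x * x ^ (2 * 1)) (fact (2 * 1) / (2 ^ 1 * fact 1))"
    by (rule std_normal_moment_even)
  have "integrable M (\<lambda>\<omega>. (R 0 \<omega>)\<^sup>2)"
    using distributed_integrable[OF R_0_normal, of "\<lambda>x. x\<^sup>2"] integrable.intros[OF 0] by simp
  moreover have "expectation (\<lambda>\<omega>. (R 0 \<omega>)\<^sup>2) = 1"
    using distributed_integral[OF R_0_normal, of "\<lambda>x. x\<^sup>2"] has_bochner_integral_integral_eq[OF 0] by simp
  moreover have "integrable M (\<lambda>\<omega>. (R t \<omega>)\<^sup>2) \<longleftrightarrow> integrable (distr M borel (R t)) (\<lambda>x. x\<^sup>2)"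
    "expectation (\<lambda>\<omega>. (R t \<omega>)\<^sup>2) = (\<integral>x. x\<^sup>2 \<partial>distr M borel (R t))" if "t \<ge> 0" for t
    using that by (subst integrable_distr_eq integral_distr; simp)+
  ultimately show "integrable M (\<lambda>\<omega>. (R t \<omega>)\<^sup>2)" "expectation (\<lambda>\<omega>. (R t \<omega>)\<^sup>2) = 1"
    using distr_R[OF assms] assms by simp_all
qed

text \<open>The inequality 2 u v \<le> u^2 + v^2 bounds |R_0| (1 + |R_t|) by 1 + R_0^2 + R_t^2,
  whose expectation is 3. The pointwise bound serves again as a dominating function when the
  integrand is varied.\<close>

lemma corr_bounds:
  assumes [measurable]: "F \<in> borel_measurable borel" and growth: "\<And>x. \<bar>F x\<bar> \<le> K * (1 + \<bar>x\<bar>)"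
    and "t \<ge> 0"
  shows "integrable M (\<lambda>\<omega>. R 0 \<omega> * F (R t \<omega>))"
    and "expectation (\<lambda>\<omega>. \<bar>R 0 \<omega> * F (R t \<omega>)\<bar>) \<le> 3 * K"
    and "\<bar>corr F t\<bar> \<le> 3 * K"
    and "\<bar>R 0 \<omega> * F (R t \<omega>)\<bar> \<le> K * (1 + (R 0 \<omega>)\<^sup>2 + (R t \<omega>)\<^sup>2)"
proof -
  note [measurable] = R_measurable[OF \<open>t \<ge> 0\<close>] R_measurable[of 0, simplified]
  have K: "K \<ge> 0" using growth[of 0] by simp
  show bnd: "\<bar>R 0 \<omega> * F (R t \<omega>)\<bar> \<le> K * (1 + (R 0 \<omega>)\<^sup>2 + (R t \<omega>)\<^sup>2)" for \<omega>
  proof -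
    have "\<bar>R 0 \<omega> * F (R t \<omega>)\<bar> \<le> \<bar>R 0 \<omega>\<bar> * (K * (1 + \<bar>R t \<omega>\<bar>))"
      unfolding abs_mult by (intro mult_left_mono growth) auto
    also have "\<dots> = K * (\<bar>R 0 \<omega>\<bar> + \<bar>R 0 \<omega>\<bar> * \<bar>R t \<omega>\<bar>)"
      by (simp add: algebra_simps)
    also have "\<bar>R 0 \<omega>\<bar> + \<bar>R 0 \<omega>\<bar> * \<bar>R t \<omega>\<bar> \<le> 1 + (R 0 \<omega>)\<^sup>2 + (R t \<omega>)\<^sup>2"
    proof -
      have "2 * \<bar>R 0 \<omega>\<bar> * 1 \<le> \<bar>R 0 \<omega>\<bar>\<^sup>2 + 1\<^sup>2" "2 * \<bar>R 0 \<omega>\<bar> * \<bar>R t \<omega>\<bar> \<le> \<bar>R 0 \<omega>\<bar>\<^sup>2 + \<bar>R t \<omega>\<bar>\<^sup>2"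
        by (rule sum_squares_bound)+
      moreover have "(R t \<omega>)\<^sup>2 \<ge> 0" by simp
      ultimately show ?thesis unfolding power2_abs mult.assoc mult_1_right power_one by linarith
    qed
    finally show ?thesis
      using K by (simp add: mult_left_mono)
  qed
  have I: "integrable M (\<lambda>\<omega>. K * (1 + (R 0 \<omega>)\<^sup>2 + (R t \<omega>)\<^sup>2))"
    using R_square \<open>t \<ge> 0\<close> by (intro integrable_mult_right Bochner_Integration.integrable_add) auto
  show int: "integrable M (\<lambda>\<omega>. R 0 \<omega> * F (R t \<omega>))"
    by (rule Bochner_Integration.integrable_bound[OF I])
       (use bnd in \<open>auto intro!: AE_I2 order_trans[OF _ abs_ge_self]\<close>)
  have "expectation (\<lambda>\<omega>. \<bar>R 0 \<omega> * F (R t \<omega>)\<bar>) \<le> expectation (\<lambda>\<omega>. K * (1 + (R 0 \<omega>)\<^sup>2 + (R t \<omega>)\<^sup>2))"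
    by (intro integral_mono integrable_abs int I bnd)
  also have "\<dots> = 3 * K"
    using R_square \<open>t \<ge> 0\<close> by (simp add: prob_space)
  finally show b: "expectation (\<lambda>\<omega>. \<bar>R 0 \<omega> * F (R t \<omega>)\<bar>) \<le> 3 * K" .
  then show "\<bar>corr F t\<bar> \<le> 3 * K"
    unfolding corr_def using integral_abs_bound[of M "\<lambda>\<omega>. R 0 \<omega> * F (R t \<omega>)"] by linarith
qed

lemma corr_0:
  assumes [measurable]: "F \<in> borel_measurable borel" and growth: "\<And>x. \<bar>F x\<bar> \<le> K * (1 + \<bar>x\<bar>)"
  shows "corr F 0 = ((\<integral>u. F u \<partial>rayleigh) - (\<integral>u. F (- u) \<partial>rayleigh)) / sqrt (2 * pi)"
  unfolding corr_def gaussian_stein_rayleigh[OF assms, symmetric]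
  by (rule distributed_integral[OF R_0_normal, of "\<lambda>x. x * F x", symmetric]) auto

sublocale time_product: pair_sigma_finite lborel M
  by standard

lemma product_measurable:
  assumes [measurable]: "F \<in> borel_measurable borel"
  shows "(\<lambda>(s, \<omega>). R 0 \<omega> * F (R (max s 0) \<omega>)) \<in> borel_measurable (borel \<Otimes>\<^sub>M M)"
proof -
  note [measurable] = R_measurable[of 0, simplified]
  have "(\<lambda>p. R 0 (snd p) * F ((\<lambda>(s, \<omega>). R (max s 0) \<omega>) p)) \<in> borel_measurable (borel \<Otimes>\<^sub>M M)"
    by measurable
  then show ?thesis by (simp add: split_beta)
qed

lemma product_integrable:
  assumes [measurable]: "F \<in> borel_measurable borel" and growth: "\<And>x. \<bar>F x\<bar> \<le> K * (1 + \<bar>x\<bar>)"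
    and w: "integrable lborel w"
  shows "integrable (lborel \<Otimes>\<^sub>M M) (\<lambda>(s, \<omega>). w s * (R 0 \<omega> * F (R (max s 0) \<omega>)))"
proof (rule time_product.Fubini_integrable)
  have [measurable]: "w \<in> borel_measurable borel"
    using borel_measurable_integrable[OF w] by simp
  have "(\<lambda>p. w (fst p) * (\<lambda>(s, \<omega>). R 0 \<omega> * F (R (max s 0) \<omega>)) p) \<in> borel_measurable (borel \<Otimes>\<^sub>M M)"
    using product_measurable[OF assms(1)] by measurable
  then show m: "(\<lambda>(s, \<omega>). w s * (R 0 \<omega> * F (R (max s 0) \<omega>))) \<in> borel_measurable (lborel \<Otimes>\<^sub>M M)"
    by (subst measurable_cong_sets[OF sets_pair_measure_cong[OF sets_lborel refl] refl]) (simp add: split_beta)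
  show "AE s in lborel. integrable M (\<lambda>\<omega>. case (s, \<omega>) of (s, \<omega>) \<Rightarrow> w s * (R 0 \<omega> * F (R (max s 0) \<omega>)))"
    unfolding case_prod_conv by (intro AE_I2 integrable_mult_right corr_bounds(1)[OF assms(1,2)]) simp
  show "integrable lborel (\<lambda>s. expectation (\<lambda>\<omega>. norm (case (s, \<omega>) of (s, \<omega>) \<Rightarrow> w s * (R 0 \<omega> * F (R (max s 0) \<omega>)))))"
  proof (rule Bochner_Integration.integrable_bound)
    show "integrable lborel (\<lambda>s. 3 * K * w s)"
      using w by (rule integrable_mult_right)
    show "(\<lambda>s. expectation (\<lambda>\<omega>. norm (case (s, \<omega>) of (s, \<omega>) \<Rightarrow> w s * (R 0 \<omega> * F (R (max s 0) \<omega>))))) \<in> borel_measurable lborel"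
      using m by measurable
    show "AE s in lborel. norm (expectation (\<lambda>\<omega>. norm (case (s, \<omega>) of (s, \<omega>) \<Rightarrow> w s * (R 0 \<omega> * F (R (max s 0) \<omega>)))))
        \<le> norm (3 * K * w s)"
    proof (rule AE_I2)
      fix s :: real
      have K: "K \<ge> 0" using growth[of 0] by simp
      have "expectation (\<lambda>\<omega>. norm (w s * (R 0 \<omega> * F (R (max s 0) \<omega>)))) =
          \<bar>w s\<bar> * expectation (\<lambda>\<omega>. \<bar>R 0 \<omega> * F (R (max s 0) \<omega>)\<bar>)"
        unfolding real_norm_def abs_mult[of "w s"] by simp
      also have "\<dots> \<le> \<bar>w s\<bar> * (3 * K)"
        by (intro mult_left_mono corr_bounds(2)[OF assms(1,2)]) auto
      finally show "norm (expectation (\<lambda>\<omega>. norm (case (s, \<omega>) of (s, \<omega>) \<Rightarrow> w s * (R 0 \<omega> * F (R (max s 0) \<omega>)))))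
        \<le> norm (3 * K * w s)"
        using K by (simp add: abs_mult mult_ac)
    qed
  qed
qed

lemma corr_measurable:
  assumes "F \<in> borel_measurable borel"
  shows "(\<lambda>t. corr F (max t 0)) \<in> borel_measurable borel"
  unfolding corr_def using product_measurable[OF assms] by measurable

end

subsection \<open>The resolvent identity\<close>

text \<open>The jump rate makes \<open>L_F f\<close> grow linearly even for bounded f: the jump
  difference is at most twice the bound of f and is multiplied by x_+. One constant serves for all
  three bounds.\<close>

lemma C1_bounded_growth:
  assumes f: "f \<in> C1_bounded" and fm [measurable]: "f \<in> borel_measurable borel"
  obtains K where "\<And>x. \<bar>f x\<bar> \<le> K" "\<And>x. \<bar>f x\<bar> \<le> K * (1 + \<bar>x\<bar>)" "\<And>x. \<bar>L_F f x\<bar> \<le> K * (1 + \<bar>x\<bar>)"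
proof -
  interpret rayleigh: prob_space rayleigh by (rule prob_space_rayleigh)
  obtain A where A: "\<And>x. \<bar>f x\<bar> \<le> A"
    using f unfolding C1_bounded_def bounded_iff by auto
  obtain B where B: "\<And>x. \<bar>deriv f x\<bar> \<le> B"
    using f unfolding C1_bounded_def bounded_iff by auto
  have AB: "A \<ge> 0" "B \<ge> 0"
    using A[of 0] B[of 0] by linarith+
  have int: "integrable rayleigh (\<lambda>u. f (- u))"
    by (rule rayleigh.integrable_const_bound[where B = A]) (use A in auto)
  have m: "\<bar>\<integral>u. f (- u) \<partial>rayleigh\<bar> \<le> A"
  proof -
    have "\<bar>\<integral>u. f (- u) \<partial>rayleigh\<bar> \<le> (\<integral>u. \<bar>f (- u)\<bar> \<partial>rayleigh)"
      by (rule integral_abs_bound)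
    also have "\<dots> \<le> (\<integral>u. A \<partial>rayleigh)"
      by (intro integral_mono integrable_abs int A rayleigh.integrable_const)
    finally show ?thesis by (simp add: rayleigh.prob_space)
  qed
  show thesis
  proof (rule that[of "2 * A + B"])
    show b: "\<bar>f x\<bar> \<le> 2 * A + B" for x using A[of x] AB by linarith
    show "\<bar>f x\<bar> \<le> (2 * A + B) * (1 + \<bar>x\<bar>)" for x
    proof -
      have "(2 * A + B) * 1 \<le> (2 * A + B) * (1 + \<bar>x\<bar>)"
        using AB by (intro mult_left_mono) auto
      then show ?thesis using order_trans[OF b] by simp
    qed
    show "\<bar>L_F f x\<bar> \<le> (2 * A + B) * (1 + \<bar>x\<bar>)" for x
    proof -
      have "\<bar>max x 0 * ((\<integral>u. f (- u) \<partial>rayleigh) - f x)\<bar> \<le> \<bar>x\<bar> * (2 * A)"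
        unfolding abs_mult
      proof (rule mult_mono)
        show "\<bar>(\<integral>u. f (- u) \<partial>rayleigh) - f x\<bar> \<le> 2 * A"
          using m A[of x] by linarith
      qed auto
      then have "\<bar>L_F f x\<bar> \<le> B + \<bar>x\<bar> * (2 * A)"
        unfolding L_F_def using B[of x] by linarith
      also have "\<dots> \<le> (2 * A + B) * (1 + \<bar>x\<bar>)"
        using AB by (simp add: algebra_simps)
      finally show ?thesis .
    qed
  qed
qed

section \<open>Adaptedness and Dynkin's formula for correlations\<close>

lemma subalgebra_natural_filtration:
  assumes "\<And>s. s \<in> {0..t} \<Longrightarrow> X s \<in> borel_measurable M"
  shows "subalgebra M (natural_filtration M X t)"
proof -
  have "(\<Union>s\<in>{0..t}. {X s -` A \<inter> space M | A. A \<in> sets borel}) \<subseteq> sets M"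
    using assms by (auto intro: measurable_sets)
  moreover have "(\<Union>s\<in>{0..t}. {X s -` A \<inter> space M | A. A \<in> sets borel}) \<subseteq> Pow (space M)"
    by auto
  ultimately show ?thesis
    unfolding subalgebra_def natural_filtration_def
    by (simp only: space_measure_of sets_measure_of sets.sigma_sets_subset simp_thms)
qed

lemma measurable_natural_filtration:
  assumes "s \<in> {0..t}"
  shows "X s \<in> borel_measurable (natural_filtration M X t)"
proof (rule measurableI)
  have sub: "(\<Union>s\<in>{0..t}. {X s -` A \<inter> space M | A. A \<in> sets borel}) \<subseteq> Pow (space M)"
    by auto
  fix A :: "real set" assume "A \<in> sets borel"
  then have "X s -` A \<inter> space M \<in> (\<Union>s\<in>{0..t}. {X s -` A \<inter> space M | A. A \<in> sets borel})"
    using assms by blast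
  then show "X s -` A \<inter> space (natural_filtration M X t) \<in> sets (natural_filtration M X t)"
    unfolding natural_filtration_def using sub by (simp add: space_measure_of)
qed simp

context forward_process
begin

lemma R_0_measurable [measurable]: "R 0 \<in> borel_measurable M"
  by simp

lemma corr_time_integral:
  assumes g [measurable]: "g \<in> borel_measurable borel" and growth: "\<And>x. \<bar>g x\<bar> \<le> K * (1 + \<bar>x\<bar>)"
  shows "(\<lambda>\<omega>. LINT s:{0..t}|lborel. g (R s \<omega>)) \<in> borel_measurable M"
    and "integrable M (\<lambda>\<omega>. R 0 \<omega> * (LINT s:{0..t}|lborel. g (R s \<omega>)))"
    and "expectation (\<lambda>\<omega>. R 0 \<omega> * (LINT s:{0..t}|lborel. g (R s \<omega>))) = (LINT s:{0..t}|lborel. corr g (max s 0))"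
    and "integrable M (\<lambda>\<omega>. \<bar>R 0 \<omega>\<bar> * (LINT s:{0..t}|lborel. \<bar>g (R s \<omega>)\<bar>))"
proof -
  have w: "integrable lborel (indicator {0..t} :: real \<Rightarrow> real)"
    by (simp add: emeasure_lborel_Icc_eq)
  note pi = product_integrable[OF g growth w]
  \<comment> \<open>On \<open>{0..t}\<close> the replacement of s by \<open>max s 0\<close> changes
    nothing, and it produces the jointly measurable extension to negative times.\<close>
  have eq: "(LINT s:{0..t}|lborel. h (R s \<omega>)) = (\<integral>s. indicator {0..t} s * h (R (max s 0) \<omega>) \<partial>lborel)" for \<omega> and h :: "real \<Rightarrow> real"
    unfolding set_lebesgue_integral_def
    by (intro Bochner_Integration.integral_cong) (auto simp: indicator_def)
  have "(\<lambda>p. indicator {0..t} (snd p) * g ((\<lambda>(s, \<omega>). R (max s 0) \<omega>) (snd p, fst p))) \<in> borel_measurable (M \<Otimes>\<^sub>M borel)"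
    by measurable
  then have "(\<lambda>(\<omega>, s). indicator {0..t} s * g (R (max s 0) \<omega>)) \<in> borel_measurable (M \<Otimes>\<^sub>M lborel)"
    by (subst measurable_cong_sets[OF sets_pair_measure_cong[OF refl sets_lborel] refl]) (simp add: split_beta)
  then show "(\<lambda>\<omega>. LINT s:{0..t}|lborel. g (R s \<omega>)) \<in> borel_measurable M"
    unfolding eq by (rule lborel.borel_measurable_lebesgue_integral)
  have r: "R 0 \<omega> * (LINT s:{0..t}|lborel. g (R s \<omega>)) = (\<integral>s. indicator {0..t} s * (R 0 \<omega> * g (R (max s 0) \<omega>)) \<partial>lborel)" for \<omega>
    unfolding eq by (subst integral_mult_right_zero[symmetric]) (simp add: mult_ac)
  show "integrable M (\<lambda>\<omega>. R 0 \<omega> * (LINT s:{0..t}|lborel. g (R s \<omega>)))"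
    unfolding r by (rule time_product.integrable_snd[OF pi])
  have "expectation (\<lambda>\<omega>. \<integral>s. indicator {0..t} s * (R 0 \<omega> * g (R (max s 0) \<omega>)) \<partial>lborel) =
      (\<integral>s. expectation (\<lambda>\<omega>. indicator {0..t} s * (R 0 \<omega> * g (R (max s 0) \<omega>))) \<partial>lborel)"
    by (rule time_product.Fubini_integral[OF pi])
  then show "expectation (\<lambda>\<omega>. R 0 \<omega> * (LINT s:{0..t}|lborel. g (R s \<omega>))) = (LINT s:{0..t}|lborel. corr g (max s 0))"
    unfolding r by (simp add: set_lebesgue_integral_def corr_def)
  have a: "\<bar>R 0 \<omega>\<bar> * (LINT s:{0..t}|lborel. \<bar>g (R s \<omega>)\<bar>) = (\<integral>s. \<bar>indicator {0..t} s * (R 0 \<omega> * g (R (max s 0) \<omega>))\<bar> \<partial>lborel)" for \<omega>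
    unfolding eq[of "\<lambda>x. \<bar>g x\<bar>"] by (subst integral_mult_right_zero[symmetric]) (simp add: mult_ac abs_mult)
  have "integrable (lborel \<Otimes>\<^sub>M M) (\<lambda>(s, \<omega>). \<bar>indicator {0..t} s * (R 0 \<omega> * g (R (max s 0) \<omega>))\<bar>)"
  proof -
    have "(\<lambda>(s, \<omega>). \<bar>indicator {0..t} s * (R 0 \<omega> * g (R (max s 0) \<omega>))\<bar>) =
        (\<lambda>p. \<bar>case p of (s, \<omega>) \<Rightarrow> indicator {0..t} s * (R 0 \<omega> * g (R (max s 0) \<omega>))\<bar>)"
      by auto
    then show ?thesis using integrable_abs[OF pi] by (simp only:)
  qed
  then show "integrable M (\<lambda>\<omega>. \<bar>R 0 \<omega>\<bar> * (LINT s:{0..t}|lborel. \<bar>g (R s \<omega>)\<bar>))"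
    unfolding a by (rule time_product.integrable_snd)
qed

text \<open>The local martingale of the generator is orthogonal to R_0, which is measurable at time
  0; Fubini then moves the expectation under the time integral.\<close>

lemma dynkin_corr:
  assumes f: "f \<in> C1_bounded" and "t \<ge> 0"
  shows "corr f t = corr f 0 + (LINT s:{0..t}|lborel. corr (L_F f) (max s 0))"
proof -
  let ?g = "L_F f"
  let ?Y = "\<lambda>t \<omega>. f (R t \<omega>) - f (R 0 \<omega>) - (LINT s:{0..t}|lborel. ?g (R s \<omega>))"
  have gen: "f \<in> borel_measurable borel" "?g \<in> borel_measurable borel"
      "AE \<omega> in M. \<forall>t\<ge>0. set_integrable lborel {0..t} (\<lambda>s. ?g (R s \<omega>))"
      "local_martingale M (natural_filtration M R) ?Y"
    using R_generator[OF f] unfolding extended_generator_def by auto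
  note [measurable] = gen(1,2) R_measurable[OF \<open>t \<ge> 0\<close>]
  obtain K where K: "\<And>x. \<bar>f x\<bar> \<le> K" "\<And>x. \<bar>f x\<bar> \<le> K * (1 + \<bar>x\<bar>)" "\<And>x. \<bar>?g x\<bar> \<le> K * (1 + \<bar>x\<bar>)"
    using C1_bounded_growth[OF f gen(1)] by metis
  note ti = corr_time_integral[OF gen(2) K(3)]
  have "integrable M (\<lambda>\<omega>. R 0 \<omega> * 1)"
    using corr_bounds(1)[of "\<lambda>_. 1" 1 0] by simp
  then have R0: "integrable M (R 0)" by simp
  have if0: "integrable M (\<lambda>\<omega>. R 0 \<omega> * f (R s \<omega>))" if "s \<ge> 0" for s
    by (rule corr_bounds(1)[OF gen(1) K(2) that])
  \<comment> \<open>The increment of f is at most 2 K, and the integral of the absolute value up to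
    t majorises the integral up to every earlier s.\<close>
  let ?B = "\<lambda>\<omega>. 2 * K * \<bar>R 0 \<omega>\<bar> + \<bar>R 0 \<omega>\<bar> * (LINT s:{0..t}|lborel. \<bar>?g (R s \<omega>)\<bar>)"
  have "expectation (\<lambda>\<omega>. R 0 \<omega> * ?Y t \<omega>) = 0"
  proof (rule local_martingale_orthogonal[OF gen(4) _ _ \<open>t \<ge> 0\<close>])
    show "subalgebra M (natural_filtration M R 0)"
      by (rule subalgebra_natural_filtration) auto
    show "R 0 \<in> borel_measurable (natural_filtration M R 0)"
      by (rule measurable_natural_filtration) auto
    show "?Y 0 \<omega> = 0" for \<omega>
      using AE_lborel_singleton[of 0]
      by (auto simp: set_lebesgue_integral_def intro!: integral_eq_zero_AE elim!: eventually_mono)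
    show "?Y t \<in> borel_measurable M"
      using ti(1)[of t] by measurable
    show "integrable M ?B"
      by (intro Bochner_Integration.integrable_add integrable_mult_right integrable_abs R0 ti(4))
    show "AE \<omega> in M. \<forall>s\<in>{0..t}. \<bar>R 0 \<omega> * ?Y s \<omega>\<bar> \<le> ?B \<omega>"
      using gen(3)
    proof eventually_elim
      case (elim \<omega>)
      show ?case
      proof
        fix s assume s: "s \<in> {0..t}"
        have it: "set_integrable lborel {0..t} (\<lambda>s. ?g (R s \<omega>))"
          using elim \<open>t \<ge> 0\<close> by blast
        have iS: "set_integrable lborel {0..s} (\<lambda>s. ?g (R s \<omega>))"
          using elim s by auto
        have "\<bar>LINT s:{0..s}|lborel. ?g (R s \<omega>)\<bar> \<le> (LINT s:{0..s}|lborel. \<bar>?g (R s \<omega>)\<bar>)"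
          using set_integral_norm_bound[OF iS] by simp
        also have "\<dots> \<le> (LINT s:{0..t}|lborel. \<bar>?g (R s \<omega>)\<bar>)"
          unfolding set_lebesgue_integral_def
        proof (rule integral_mono)
          show "integrable lborel (\<lambda>u. indicator {0..s} u *\<^sub>R \<bar>?g (R u \<omega>)\<bar>)"
            using set_integrable_abs[OF iS] by (simp add: set_integrable_def)
          show "integrable lborel (\<lambda>u. indicator {0..t} u *\<^sub>R \<bar>?g (R u \<omega>)\<bar>)"
            using set_integrable_abs[OF it] by (simp add: set_integrable_def)
        qed (use s in \<open>auto simp: indicator_def\<close>)
        finally have "\<bar>?Y s \<omega>\<bar> \<le> 2 * K + (LINT s:{0..t}|lborel. \<bar>?g (R s \<omega>)\<bar>)"
          using K(1)[of "R s \<omega>"] K(1)[of "R 0 \<omega>"] by linarith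
        then have "\<bar>R 0 \<omega>\<bar> * \<bar>?Y s \<omega>\<bar> \<le> \<bar>R 0 \<omega>\<bar> * (2 * K + (LINT s:{0..t}|lborel. \<bar>?g (R s \<omega>)\<bar>))"
          by (rule mult_left_mono) simp
        then show "\<bar>R 0 \<omega> * ?Y s \<omega>\<bar> \<le> ?B \<omega>"
          by (simp only: abs_mult distrib_left mult_ac)
      qed
    qed
  qed
  also have "expectation (\<lambda>\<omega>. R 0 \<omega> * ?Y t \<omega>) = corr f t - corr f 0 - (LINT s:{0..t}|lborel. corr ?g (max s 0))"
  proof -
    have "expectation (\<lambda>\<omega>. R 0 \<omega> * ?Y t \<omega>) = expectation (\<lambda>\<omega>. R 0 \<omega> * f (R t \<omega>) - R 0 \<omega> * f (R 0 \<omega>) -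
        R 0 \<omega> * (LINT s:{0..t}|lborel. ?g (R s \<omega>)))"
      by (simp only: right_diff_distrib)
    also have "\<dots> = corr f t - corr f 0 - (LINT s:{0..t}|lborel. corr ?g (max s 0))"
      unfolding corr_def[of f] ti(3)[symmetric] using if0 \<open>t \<ge> 0\<close> ti(2) by simp
    finally show ?thesis .
  qed
  finally show ?thesis by simp
qed

lemma corr_laplace_integrable:
  assumes [measurable]: "F \<in> borel_measurable borel" and growth: "\<And>x. \<bar>F x\<bar> \<le> K * (1 + \<bar>x\<bar>)" and "\<rho> > 0"
  shows "set_integrable lborel {0..} (\<lambda>t. exp (- \<rho> * t) * corr F (max t 0))"
proof (rule set_integrable_bound)
  show "set_integrable lborel {0..} (\<lambda>t. 3 * K * (t ^ 0 * exp (- \<rho> * t)))"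
    by (intro set_integrable_mult_right set_integrable_power_exp \<open>\<rho> > 0\<close>)
  show "set_borel_measurable lborel {0..} (\<lambda>t. exp (- \<rho> * t) * corr F (max t 0))"
    unfolding set_borel_measurable_def using corr_measurable[OF assms(1)] by measurable
  have K: "K \<ge> 0" using growth[of 0] by simp
  show "AE t in lborel. t \<in> {0..} \<longrightarrow> norm (exp (- \<rho> * t) * corr F (max t 0)) \<le> norm (3 * K * (t ^ 0 * exp (- \<rho> * t)))"
    using corr_bounds(3)[OF assms(1,2)] K by (auto intro!: AE_I2 simp: abs_mult)
qed

text \<open>Multiply Dynkin's formula by \<rho> exp(- \<rho> t) and integrate. The factor 1 / \<rho>
  from \<open>laplace_primitive\<close> cancels \<rho>, so the two contributions of
  \<open>L_F f\<close> cancel and the initial correlation remains.\<close>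

lemma resolvent_corr:
  assumes f: "f \<in> C1_bounded" and "\<rho> > 0"
  shows "(LINT t:{0..}|lborel. exp (- \<rho> * t) * corr (\<lambda>x. \<rho> * f x - L_F f x) t) = corr f 0"
proof -
  let ?g = "L_F f" and ?e = "\<lambda>t. exp (- \<rho> * t)"
  let ?v = "\<lambda>s. corr ?g (max s 0)"
  let ?I = "\<lambda>t. LINT s:{0..t}|lborel. ?v s"
  have gen: "f \<in> borel_measurable borel" "?g \<in> borel_measurable borel"
    using R_generator[OF f] unfolding extended_generator_def by auto
  obtain K where K: "\<And>x. \<bar>f x\<bar> \<le> K * (1 + \<bar>x\<bar>)" "\<And>x. \<bar>?g x\<bar> \<le> K * (1 + \<bar>x\<bar>)"
    using C1_bounded_growth[OF f gen(1)] by metis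
  have v: "?v \<in> borel_measurable borel" "\<And>s. s \<ge> 0 \<Longrightarrow> \<bar>?v s\<bar> \<le> 3 * K"
    using corr_measurable[OF gen(2)] corr_bounds(3)[OF gen(2) K(2)] by auto
  note L = laplace_primitive[OF v \<open>\<rho> > 0\<close>]
  have ei: "set_integrable lborel {0..} ?e"
    using set_integrable_power_exp[OF \<open>\<rho> > 0\<close>, of 0] by simp
  have ev: "set_integrable lborel {0..} (\<lambda>t. ?e t * ?v t)"
    by (rule corr_laplace_integrable[OF gen(2) K(2) \<open>\<rho> > 0\<close>])
  have "(LINT t:{0..}|lborel. ?e t * corr (\<lambda>x. \<rho> * f x - ?g x) t) =
      (LINT t:{0..}|lborel. \<rho> * corr f 0 * ?e t + \<rho> * (?e t * ?I t) - ?e t * ?v t)"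
  proof (rule set_lebesgue_integral_cong)
    show "\<forall>t. t \<in> {0..} \<longrightarrow> ?e t * corr (\<lambda>x. \<rho> * f x - ?g x) t =
        \<rho> * corr f 0 * ?e t + \<rho> * (?e t * ?I t) - ?e t * ?v t"
    proof (intro allI impI)
      fix t :: real assume "t \<in> {0..}"
      then have t: "t \<ge> 0" by simp
      have "corr (\<lambda>x. \<rho> * f x - ?g x) t = expectation (\<lambda>\<omega>. \<rho> * (R 0 \<omega> * f (R t \<omega>)) - R 0 \<omega> * ?g (R t \<omega>))"
        unfolding corr_def by (simp add: algebra_simps)
      also have "\<dots> = \<rho> * corr f t - corr ?g t"
        unfolding corr_def using corr_bounds(1)[OF gen(1) K(1) t] corr_bounds(1)[OF gen(2) K(2) t] by simp
      also have "corr f t = corr f 0 + ?I t"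
        by (rule dynkin_corr[OF f t])
      finally have c: "corr (\<lambda>x. \<rho> * f x - ?g x) t = \<rho> * (corr f 0 + ?I t) - corr ?g t" .
      show "?e t * corr (\<lambda>x. \<rho> * f x - ?g x) t =
          \<rho> * corr f 0 * ?e t + \<rho> * (?e t * ?I t) - ?e t * ?v t"
        unfolding c using t by (simp add: algebra_simps)
    qed
  qed simp
  also have "\<dots> = \<rho> * corr f 0 * (LINT t:{0..}|lborel. ?e t) + \<rho> * (LINT t:{0..}|lborel. ?e t * ?I t) -
      (LINT t:{0..}|lborel. ?e t * ?v t)"
    using ei ev L(1) by (subst set_integral_diff set_integral_add; simp)+
  also have "\<dots> = corr f 0"
    using set_integral_exp[OF \<open>\<rho> > 0\<close>, of 0] \<open>\<rho> > 0\<close> L(2) by simp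
  finally show ?thesis .
qed

text \<open>Two nested dominated convergences, over \<omega> at fixed t and then over t; a growth
  constant independent of n serves both.\<close>

lemma corr_laplace_limit:
  assumes hm [measurable]: "\<And>n. h n \<in> borel_measurable borel"
    and growth: "\<And>n x. \<bar>h n x\<bar> \<le> K * (1 + \<bar>x\<bar>)"
    and lim: "\<And>x. (\<lambda>n. h n x) \<longlonglongrightarrow> F x" and [measurable]: "F \<in> borel_measurable borel" and "\<rho> > 0"
  shows "(\<lambda>n. LINT t:{0..}|lborel. exp (- \<rho> * t) * corr (h n) t) \<longlonglongrightarrow>
    (LINT t:{0..}|lborel. exp (- \<rho> * t) * corr F t)"
proof -
  have growthF: "\<bar>F x\<bar> \<le> K * (1 + \<bar>x\<bar>)" for x
    by (rule LIMSEQ_le_const2[OF tendsto_rabs[OF lim]]) (use growth in auto)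
  have corr_lim: "(\<lambda>n. corr (h n) t) \<longlonglongrightarrow> corr F t" if t: "t \<ge> 0" for t
    unfolding corr_def
  proof (rule integral_dominated_convergence[where w = "\<lambda>\<omega>. K * (1 + (R 0 \<omega>)\<^sup>2 + (R t \<omega>)\<^sup>2)"])
    note [measurable] = R_measurable[OF t]
    show "(\<lambda>\<omega>. R 0 \<omega> * F (R t \<omega>)) \<in> borel_measurable M" "(\<lambda>\<omega>. R 0 \<omega> * h n (R t \<omega>)) \<in> borel_measurable M" for n
      by measurable
    show "integrable M (\<lambda>\<omega>. K * (1 + (R 0 \<omega>)\<^sup>2 + (R t \<omega>)\<^sup>2))"
      using R_square t by (intro integrable_mult_right Bochner_Integration.integrable_add) auto
    show "AE \<omega> in M. (\<lambda>n. R 0 \<omega> * h n (R t \<omega>)) \<longlonglongrightarrow> R 0 \<omega> * F (R t \<omega>)"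
      by (intro AE_I2 tendsto_intros lim)
    show "AE \<omega> in M. norm (R 0 \<omega> * h n (R t \<omega>)) \<le> K * (1 + (R 0 \<omega>)\<^sup>2 + (R t \<omega>)\<^sup>2)" for n
      using corr_bounds(4)[OF hm growth t] by auto
  qed
  have eq: "(LINT t:{0..}|lborel. exp (- \<rho> * t) * corr G t) =
      (\<integral>t. indicator {0..} t *\<^sub>R (exp (- \<rho> * t) * corr G (max t 0)) \<partial>lborel)" for G
    unfolding set_lebesgue_integral_def
    by (intro Bochner_Integration.integral_cong) (auto simp: indicator_def)
  have K: "K \<ge> 0" using growth[of 0 0] by simp
  show ?thesis
    unfolding eq
  proof (rule integral_dominated_convergence[where w = "\<lambda>t. indicator {0..} t *\<^sub>R (3 * K * (t ^ 0 * exp (- \<rho> * t)))"])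
    show "(\<lambda>t. indicator {0..} t *\<^sub>R (exp (- \<rho> * t) * corr F (max t 0))) \<in> borel_measurable lborel"
      "(\<lambda>t. indicator {0..} t *\<^sub>R (exp (- \<rho> * t) * corr (h n) (max t 0))) \<in> borel_measurable lborel" for n
      using corr_measurable[of F] corr_measurable[OF hm[of n]] by measurable
    show "integrable lborel (\<lambda>t. indicator {0..} t *\<^sub>R (3 * K * (t ^ 0 * exp (- \<rho> * t))))"
      using set_integrable_mult_right[OF set_integrable_power_exp[OF \<open>\<rho> > 0\<close>, of 0], of "3 * K"]
      unfolding set_integrable_def .
    show "AE t in lborel. (\<lambda>n. indicator {0..} t *\<^sub>R (exp (- \<rho> * t) * corr (h n) (max t 0))) \<longlonglongrightarrow>
        indicator {0..} t *\<^sub>R (exp (- \<rho> * t) * corr F (max t 0))"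
      by (intro AE_I2 tendsto_intros corr_lim) simp
    show "AE t in lborel. norm (indicator {0..} t *\<^sub>R (exp (- \<rho> * t) * corr (h n) (max t 0))) \<le>
        indicator {0..} t *\<^sub>R (3 * K * (t ^ 0 * exp (- \<rho> * t)))" for n
      using corr_bounds(3)[OF hm growth] K
      by (auto intro!: AE_I2 simp: abs_mult indicator_def)
  qed
qed

end

subsection \<open>Approximate solutions of the resolvent equation\<close>

lemma DERIV_If_nonneg:
  fixes f g f' g' :: "real \<Rightarrow> real"
  assumes f: "\<And>x. x \<ge> 0 \<Longrightarrow> (f has_real_derivative f' x) (at x)"
    and g: "\<And>x. x \<le> 0 \<Longrightarrow> (g has_real_derivative g' x) (at x)"
    and "f 0 = g 0" "f' 0 = g' 0"
  shows "((\<lambda>x. if x \<ge> 0 then f x else g x) has_real_derivative (if x \<ge> 0 then f' x else g' x)) (at x)"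
proof -
  have "((\<lambda>x. if x \<in> {0..} then f x else g x) has_vector_derivative
      (if x \<in> {0..} then f' x else g' x)) (at x within UNIV)"
    by (rule has_vector_derivative_If_within_closures[where T = "{..<0}"])
       (use assms in \<open>auto simp: has_real_derivative_iff_has_vector_derivative[symmetric]
         intro: has_field_derivative_at_within\<close>)
  then show ?thesis
    by (simp add: has_real_derivative_iff_has_vector_derivative)
qed

lemma continuous_on_If_nonneg:
  fixes f g :: "real \<Rightarrow> real"
  assumes "continuous_on {0..} f" "continuous_on {..0} g" "f 0 = g 0"
  shows "continuous_on UNIV (\<lambda>x. if x \<ge> 0 then f x else g x)"
proof -
  have "continuous_on ({0..} \<union> {..0}) (\<lambda>x. if x \<ge> 0 then f x else g x)"
    by (rule continuous_on_cases) (use assms in auto)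
  moreover have "{0..} \<union> {..0} = (UNIV :: real set)"
    by auto
  ultimately show ?thesis by simp
qed

text \<open>For x < 0, |N x / (N - x)| is half the harmonic mean of N and |x|. The bound by N makes
  each approximate solution bounded; the bound by |x| is uniform in N and serves for dominated
  convergence.\<close>

lemma fraction_bounds:
  fixes x N :: real
  assumes N: "N > 0" and "x \<le> 0"
  shows "0 < N / (N - x)" "N / (N - x) \<le> 1" "\<bar>N * x / (N - x)\<bar> \<le> \<bar>x\<bar>" "\<bar>N * x / (N - x)\<bar> \<le> N"
proof -
  have p: "N - x > 0" using N assms by linarith
  show 1: "0 < N / (N - x)" "N / (N - x) \<le> 1" using N p assms by simp_all
  have "\<bar>N * x / (N - x)\<bar> = N / (N - x) * \<bar>x\<bar>"
    using 1(1) by (simp add: abs_mult)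
       (use N p in simp)
  also have "\<dots> \<le> 1 * \<bar>x\<bar>"
    using 1 by (intro mult_right_mono) auto
  finally show "\<bar>N * x / (N - x)\<bar> \<le> \<bar>x\<bar>" by simp
  have "\<bar>N * x / (N - x)\<bar> = N * ((- x) / (N - x))"
    using N p assms by (simp add: abs_mult)
  also have "(- x) / (N - x) \<le> 1"
    by (subst pos_divide_le_eq[OF p]) (use N in simp)
  then have "N * ((- x) / (N - x)) \<le> N * 1"
    using N by (intro mult_left_mono) auto
  finally show "\<bar>N * x / (N - x)\<bar> \<le> N" by simp
qed

lemma fraction_bound_square:
  fixes u N :: real
  assumes "N > 0" "u \<ge> 0"
  shows "\<bar>u * (N * u / (N + u))\<bar> \<le> u\<^sup>2"
  using mult_left_mono[OF fraction_bounds(3)[of N "- u"], of u] assms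
  by (simp add: abs_mult power2_eq_square)

text \<open>The exact solution is \<open>res_pos\<close> on the right and the limit \<open>N \<rightarrow> \<infinity>\<close> of \<open>res_neg\<close> on the left: the unbounded term \<open>x / \<rho>\<close>
  is replaced by \<open>(N x / (N - x)) / \<rho>\<close>, whose value and slope at \<open>0\<close> are the same, so that the two pieces still
  fit together continuously differentiably.\<close>

definition res_pos :: "real \<Rightarrow> real \<Rightarrow> real" where
  "res_pos \<rho> x = fwd_c \<rho> * (1 - \<rho> * gauss_moment 0 (\<rho> + x))"

definition res_neg :: "real \<Rightarrow> real \<Rightarrow> real \<Rightarrow> real" where
  "res_neg \<rho> N x = exp (\<rho> * x) * (fwd_c \<rho> * gauss_moment 1 \<rho> - 1 / \<rho>\<^sup>2) + 1 / \<rho>\<^sup>2 + N * x / (N - x) / \<rho>"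

definition res :: "real \<Rightarrow> real \<Rightarrow> real \<Rightarrow> real" where
  "res \<rho> N x = (if x \<ge> 0 then res_pos \<rho> x else res_neg \<rho> N x)"

context
  fixes \<rho> N :: real
  assumes \<rho>: "\<rho> > 0" and N: "N > 0"
begin

definition res_pos' :: "real \<Rightarrow> real" where
  "res_pos' x = fwd_c \<rho> * (\<rho> * (1 - (\<rho> + x) * gauss_moment 0 (\<rho> + x)))"

definition res_neg' :: "real \<Rightarrow> real" where
  "res_neg' x = exp (\<rho> * x) * \<rho> * (fwd_c \<rho> * gauss_moment 1 \<rho> - 1 / \<rho>\<^sup>2) + (N / (N - x))\<^sup>2 / \<rho>"

text \<open>The coefficient of the exponential is chosen so that the values agree. The slopes then
  agree as well: the jump rate vanishes at 0, so both pieces satisfy f'(0) = \<rho> f(0), the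
  fraction having slope 1 there.\<close>

lemma res_0: "res_pos \<rho> 0 = res_neg \<rho> N 0" "res_pos' 0 = res_neg' 0"
proof -
  have "\<rho> * gauss_moment 0 \<rho> = 1 - gauss_moment 1 \<rho>"
    using gauss_moment_1[of \<rho>] \<rho> by simp
  then show "res_pos \<rho> 0 = res_neg \<rho> N 0" "res_pos' 0 = res_neg' 0"
    using \<rho> N unfolding res_pos_def res_neg_def res_pos'_def res_neg'_def
    by (simp_all add: right_diff_distrib power2_eq_square)
qed

lemma res_pos_DERIV:
  assumes "x \<ge> 0"
  shows "(res_pos \<rho> has_real_derivative res_pos' x) (at x)"
proof -
  have "((\<lambda>x. gauss_moment 0 (\<rho> + x)) has_real_derivative (\<rho> + x) * gauss_moment 0 (\<rho> + x) - 1) (at x)"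
    using DERIV_shift[of "gauss_moment 0" "(\<rho> + x) * gauss_moment 0 (\<rho> + x) - 1" x \<rho>] mills_DERIV[of "\<rho> + x"] \<rho> assms
    by (simp add: add.commute)
  then have "((\<lambda>x. fwd_c \<rho> * (1 - \<rho> * gauss_moment 0 (\<rho> + x))) has_real_derivative
      fwd_c \<rho> * (0 - \<rho> * ((\<rho> + x) * gauss_moment 0 (\<rho> + x) - 1))) (at x)"
    by (intro DERIV_cmult DERIV_diff DERIV_const)
  then show ?thesis
    unfolding res_pos_def[abs_def] res_pos'_def by (simp add: right_diff_distrib)
qed

lemma res_neg_DERIV:
  assumes "x \<le> 0"
  shows "(res_neg \<rho> N has_real_derivative res_neg' x) (at x)"
proof -
  have "N - x > 0" using N assms by linarith
  then have "((\<lambda>x. N * x / (N - x)) has_real_derivative (N / (N - x))\<^sup>2) (at x)"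
    by (auto intro!: derivative_eq_intros simp: power2_eq_square field_simps)
  moreover have "((\<lambda>x. exp (\<rho> * x)) has_real_derivative exp (\<rho> * x) * \<rho>) (at x)"
    by (auto intro!: derivative_eq_intros)
  ultimately have "((\<lambda>x. exp (\<rho> * x) * (fwd_c \<rho> * gauss_moment 1 \<rho> - 1 / \<rho>\<^sup>2) + 1 / \<rho>\<^sup>2 + N * x / (N - x) / \<rho>)
      has_real_derivative exp (\<rho> * x) * \<rho> * (fwd_c \<rho> * gauss_moment 1 \<rho> - 1 / \<rho>\<^sup>2) + 0 + (N / (N - x))\<^sup>2 / \<rho>) (at x)"
    by (intro DERIV_add DERIV_const DERIV_cdivide DERIV_cmult_right)
  then show ?thesis
    unfolding res_neg_def[abs_def] res_neg'_def by simp
qed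

lemma res_DERIV: "(res \<rho> N has_real_derivative (if x \<ge> 0 then res_pos' x else res_neg' x)) (at x)"
  unfolding res_def[abs_def] by (intro DERIV_If_nonneg res_pos_DERIV res_neg_DERIV res_0)

lemma deriv_res: "deriv (res \<rho> N) = (\<lambda>x. if x \<ge> 0 then res_pos' x else res_neg' x)"
  using DERIV_imp_deriv[OF res_DERIV] by blast

lemma res_C1_bounded: "res \<rho> N \<in> C1_bounded"
proof -
  let ?B = "fwd_c \<rho> * gauss_moment 1 \<rho> - 1 / \<rho>\<^sup>2"
  have e: "\<bar>exp (\<rho> * x) * b\<bar> \<le> \<bar>b\<bar>" if "x \<le> 0" for x b
    using \<rho> that by (auto simp: abs_mult mult_le_0_iff intro!: mult_left_le_one_le)
  have "\<bar>res \<rho> N x\<bar> \<le> \<bar>fwd_c \<rho>\<bar> + (\<bar>?B\<bar> + 1 / \<rho>\<^sup>2 + N / \<rho>)" for x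
  proof (cases "x \<ge> 0")
    case True
    have "\<bar>1 - \<rho> * gauss_moment 0 (\<rho> + x)\<bar> \<le> 1"
      using mills_bounds[OF \<rho> True] \<rho> by (simp add: abs_if)
    then have "\<bar>fwd_c \<rho> * (1 - \<rho> * gauss_moment 0 (\<rho> + x))\<bar> \<le> \<bar>fwd_c \<rho>\<bar>"
      by (simp add: abs_mult mult_left_le)
    moreover have "\<bar>?B\<bar> + 1 / \<rho>\<^sup>2 + N / \<rho> \<ge> 0" using \<rho> N by simp
    ultimately show ?thesis using True by (simp add: res_def res_pos_def)
  next
    case False
    then have x: "x \<le> 0" by simp
    have "\<bar>N * x / (N - x) / \<rho>\<bar> \<le> N / \<rho>"
      using divide_right_mono[OF fraction_bounds(4)[OF N x], of \<rho>] \<rho>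
      by (simp only: abs_divide[of _ \<rho>] abs_of_pos less_imp_le)
    moreover have "\<bar>1 / \<rho>\<^sup>2\<bar> = 1 / \<rho>\<^sup>2" using \<rho> by simp
    ultimately have "\<bar>res_neg \<rho> N x\<bar> \<le> \<bar>?B\<bar> + 1 / \<rho>\<^sup>2 + N / \<rho>"
      unfolding res_neg_def using e[OF x, of ?B] by linarith
    then show ?thesis using False by (simp add: res_def)
  qed
  then have 1: "bounded (range (res \<rho> N))"
    unfolding bounded_iff by auto
  have "\<bar>deriv (res \<rho> N) x\<bar> \<le> \<bar>fwd_c \<rho>\<bar> * \<rho> + (\<bar>\<rho> * ?B\<bar> + 1 / \<rho>)" for x
  proof (cases "x \<ge> 0")
    case True
    have "\<bar>1 - (\<rho> + x) * gauss_moment 0 (\<rho> + x)\<bar> \<le> 1"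
      using mills_bounds[OF \<rho> True] \<rho> True by (simp add: abs_if)
    then have "\<bar>res_pos' x\<bar> \<le> \<bar>fwd_c \<rho>\<bar> * \<rho>"
      unfolding res_pos'_def abs_mult using \<rho> by (intro mult_left_mono) (simp_all add: mult_left_le)
    moreover have "\<bar>\<rho> * ?B\<bar> + 1 / \<rho> \<ge> 0" using \<rho> by simp
    ultimately show ?thesis using True by (simp add: deriv_res)
  next
    case False
    then have x: "x \<le> 0" by simp
    have "(N / (N - x))\<^sup>2 \<le> 1"
      using fraction_bounds[OF N x] by (intro power_le_one) auto
    then have "\<bar>(N / (N - x))\<^sup>2 / \<rho>\<bar> \<le> 1 / \<rho>"
      using \<rho> by (simp add: divide_right_mono)
    moreover have "\<bar>exp (\<rho> * x) * \<rho> * ?B\<bar> \<le> \<bar>\<rho> * ?B\<bar>"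
      using e[OF x, of "\<rho> * ?B"] by (simp only: mult.assoc)
    ultimately have "\<bar>res_neg' x\<bar> \<le> \<bar>\<rho> * ?B\<bar> + 1 / \<rho>"
      unfolding res_neg'_def by linarith
    moreover have "\<bar>fwd_c \<rho>\<bar> * \<rho> \<ge> 0" using \<rho> by simp
    ultimately show ?thesis using False by (simp add: deriv_res)
  qed
  then have 2: "bounded (range (deriv (res \<rho> N)))"
    unfolding bounded_iff by auto
  have 3: "continuous_on UNIV (deriv (res \<rho> N))"
    unfolding deriv_res
  proof (intro continuous_on_If_nonneg res_0)
    show "continuous_on {0..} res_pos'"
      unfolding res_pos'_def[abs_def]
      by (intro continuous_intros continuous_on_compose2[OF mills_continuous]) (use \<rho> in auto)
    show "continuous_on {..0} res_neg'"
      unfolding res_neg'_def[abs_def] by (intro continuous_intros) (use \<rho> N in auto)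
  qed
  show ?thesis
    unfolding C1_bounded_def using 1 2 3 res_DERIV real_differentiable_def by blast
qed

definition res_mean :: real where
  "res_mean = gauss_moment 1 \<rho> * (fwd_c \<rho> * gauss_moment 1 \<rho> - 1 / \<rho>\<^sup>2) + 1 / \<rho>\<^sup>2 -
     (LINT u:{0..}|lborel. u * (N * u / (N + u)) * exp (- (u\<^sup>2 / 2))) / \<rho>"

lemma res_measurable [measurable]: "res \<rho> N \<in> borel_measurable borel"
  by (intro borel_measurable_continuous_onI continuous_at_imp_continuous_on ballI DERIV_isCont[OF res_DERIV])

lemma rayleigh_res_neg: "(\<integral>u. res \<rho> N (- u) \<partial>rayleigh) = res_mean"
proof -
  let ?B = "fwd_c \<rho> * gauss_moment 1 \<rho> - 1 / \<rho>\<^sup>2"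
  let ?t = "\<lambda>u. u * (N * u / (N + u)) * exp (- (u\<^sup>2 / 2))"
  \<comment> \<open>The exponent is written with \<open>0 * u\<close> so that the second integral
    folds to \<open>gauss_moment 1 0\<close>.\<close>
  have i: "set_integrable lborel {0..} (\<lambda>u. ?B * (u ^ 1 * exp (- (\<rho> * u) - u\<^sup>2 / 2)))"
    "set_integrable lborel {0..} (\<lambda>u. 1 / \<rho>\<^sup>2 * (u ^ 1 * exp (- (0 * u) - u\<^sup>2 / 2)))"
    "set_integrable lborel {0..} (\<lambda>u. 1 / \<rho> * ?t u)"
  proof -
    have "set_integrable lborel {0..} ?t"
    proof (rule gauss_dominated_integrable[where C = 1 and k = 2])
      show "\<bar>u * (N * u / (N + u))\<bar> \<le> 1 * u ^ 2" if "u \<ge> 0" for u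
        using fraction_bound_square[OF N that] by simp
    qed measurable
    then show "set_integrable lborel {0..} (\<lambda>u. 1 / \<rho> * ?t u)"
      by (rule set_integrable_mult_right)
  qed (intro set_integrable_mult_right gauss_moment_integrable, use \<rho> in simp)+
  have "(\<integral>u. res \<rho> N (- u) \<partial>rayleigh) = (LINT u:{0..}|lborel. u * res \<rho> N (- u) * exp (- (u\<^sup>2 / 2)))"
    by (rule rayleigh_integral) measurable
  also have "\<dots> = (LINT u:{0..}|lborel. ?B * (u ^ 1 * exp (- (\<rho> * u) - u\<^sup>2 / 2)) +
      1 / \<rho>\<^sup>2 * (u ^ 1 * exp (- (0 * u) - u\<^sup>2 / 2)) - 1 / \<rho> * ?t u)"
  proof (intro set_lebesgue_integral_cong allI impI)
    fix u :: real assume "u \<in> {0..}"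
    \<comment> \<open>At u = 0 the definition of \<open>res\<close> selects the right branch; the
      two branches agree there.\<close>
    then have "res \<rho> N (- u) = res_neg \<rho> N (- u)"
      using res_0(1) by (cases "u = 0") (auto simp: res_def)
    then have r: "res \<rho> N (- u) = exp (- (\<rho> * u)) * ?B + 1 / \<rho>\<^sup>2 - N * u / (N + u) / \<rho>"
      by (simp add: res_neg_def)
    have "exp (- (\<rho> * u) - u\<^sup>2 / 2) = exp (- (\<rho> * u)) * exp (- (u\<^sup>2 / 2))"
      by (simp add: mult_exp_exp)
    moreover have "exp (- (0 * u) - u\<^sup>2 / 2) = exp (- (u\<^sup>2 / 2))"
      by simp
    moreover have ring: "u * (e * b + r - q / \<rho>) * g = b * (u * (e * g)) + r * (u * g) - 1 / \<rho> * (u * q * g)"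
      for e b r q g :: real
      by (simp add: algebra_simps)
    ultimately show "u * res \<rho> N (- u) * exp (- (u\<^sup>2 / 2)) = ?B * (u ^ 1 * exp (- (\<rho> * u) - u\<^sup>2 / 2)) +
      1 / \<rho>\<^sup>2 * (u ^ 1 * exp (- (0 * u) - u\<^sup>2 / 2)) - 1 / \<rho> * ?t u"
      unfolding r power_one_right by (simp only: ring)
  qed simp
  also have "\<dots> = ?B * gauss_moment 1 \<rho> + 1 / \<rho>\<^sup>2 * gauss_moment 1 0 - 1 / \<rho> * (LINT u:{0..}|lborel. ?t u)"
    by (simp only: set_integral_diff(2)[OF set_integral_add(1)[OF i(1,2)] i(3)]
        set_integral_add(2)[OF i(1,2)] set_integral_mult_right gauss_moment_def[symmetric])
  also have "\<dots> = res_mean"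
    using gauss_moment_1[of 0] by (simp add: res_mean_def mult.commute)
  finally show ?thesis .
qed

text \<open>Truncation affects only the left piece, so this mean has its exact value c (1 - a) for
  every N.\<close>

lemma rayleigh_res_pos: "(\<integral>u. res \<rho> N u \<partial>rayleigh) = fwd_c \<rho> * (1 - fwd_a \<rho>)"
proof -
  have i: "set_integrable lborel {0..} (\<lambda>u. fwd_c \<rho> * (u ^ 1 * exp (- (0 * u) - u\<^sup>2 / 2)))"
    "set_integrable lborel {0..} (\<lambda>u. fwd_c \<rho> * \<rho> * (u * gauss_moment 0 (\<rho> + u) * exp (- (u\<^sup>2 / 2))))"
    by (intro set_integrable_mult_right gauss_moment_integrable rayleigh_mean_mills(1) \<rho>, simp?)+
  have "(\<integral>u. res \<rho> N u \<partial>rayleigh) = (LINT u:{0..}|lborel. u * res \<rho> N u * exp (- (u\<^sup>2 / 2)))"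
    by (rule rayleigh_integral) measurable
  also have "\<dots> = (LINT u:{0..}|lborel. fwd_c \<rho> * (u ^ 1 * exp (- (0 * u) - u\<^sup>2 / 2)) -
      fwd_c \<rho> * \<rho> * (u * gauss_moment 0 (\<rho> + u) * exp (- (u\<^sup>2 / 2))))"
    by (intro set_lebesgue_integral_cong) (auto simp: res_def res_pos_def algebra_simps)
  also have "\<dots> = fwd_c \<rho> * gauss_moment 1 0 - fwd_c \<rho> * \<rho> * ((gauss_moment 0 \<rho> - gauss_moment 0 0) / \<rho>\<^sup>2 + 1 / \<rho>)"
    by (simp only: set_integral_diff(2)[OF i] set_integral_mult_right gauss_moment_def[of 1 0] rayleigh_mean_mills(2)[OF \<rho>])
  also have "\<dots> = fwd_c \<rho> * (1 - fwd_a \<rho>)"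
    using gauss_moment_1[of 0] \<rho> by (simp add: fwd_a_def field_simps power2_eq_square)
  finally show ?thesis .
qed

text \<open>\<open>fwd_c\<close> keeps its limiting value instead of being refitted for each N. On
  the right the mismatch with \<open>res_mean\<close> therefore becomes a factor tending to 1; on
  the left truncation replaces x and adds a defect of size at most 1 / \<rho>.\<close>

lemma res_resolvent_equation:
  "\<rho> * res \<rho> N x - L_F (res \<rho> N) x =
    (if x \<ge> 0 then x * (fwd_c \<rho> - res_mean) else N * x / (N - x) + (1 - (N / (N - x))\<^sup>2) / \<rho>)"
proof -
  have "\<rho> * (e * b + 1 / \<rho>\<^sup>2 + q / \<rho>) - (e * \<rho> * b + r / \<rho>) = q + (1 - r) / \<rho>" for e b q r :: real
    using \<rho> by (simp add: algebra_simps power2_eq_square diff_divide_distrib)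
  note ring = this
  show ?thesis
  proof (cases "x \<ge> 0")
    case True
    then show ?thesis
      unfolding L_F_def rayleigh_res_neg deriv_res
      by (simp add: res_def res_pos_def res_pos'_def max_def algebra_simps)
  next
    case False
    then have "max x 0 = 0" by simp
    with False show ?thesis
      unfolding L_F_def rayleigh_res_neg deriv_res
      by (simp only: res_def res_neg_def res_neg'_def if_False mult_zero_left add_0_right ring)
  qed
qed

end

subsection \<open>The closed form of the variance\<close>

text \<open>The condition c = 1 + E[f(-\<tau>)] is recovered in the limit: dominated convergence
  turns the truncated integral into E[\<tau>] = \<open>gauss_moment 2 0\<close> =
  \<open>gauss_moment 0 0\<close>.\<close>

lemma res_mean_tendsto:
  assumes "\<rho> > 0"
  shows "(\<lambda>n. res_mean \<rho> (real (Suc n))) \<longlonglongrightarrow> fwd_c \<rho> - 1"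
proof -
  let ?t = "\<lambda>N u. u * (N * u / (N + u)) * exp (- (u\<^sup>2 / 2))"
  have "(\<lambda>n. LINT u:{0..}|lborel. ?t (real (Suc n)) u) \<longlonglongrightarrow> (LINT u:{0..}|lborel. u ^ 2 * exp (- (u\<^sup>2 / 2)))"
    unfolding set_lebesgue_integral_def
  proof (rule integral_dominated_convergence[where w = "\<lambda>u. indicator {0..} u *\<^sub>R (u ^ 2 * exp (- (u\<^sup>2 / 2)))"])
    show "integrable lborel (\<lambda>u::real. indicator {0..} u *\<^sub>R (u ^ 2 * exp (- (u\<^sup>2 / 2))))"
      using gauss_halfline_integrable[of 2] unfolding set_integrable_def .
    show "AE u in lborel. (\<lambda>n. indicator {0..} u *\<^sub>R ?t (real (Suc n)) u) \<longlonglongrightarrow>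
        indicator {0..} u *\<^sub>R (u ^ 2 * exp (- (u\<^sup>2 / 2)))"
    proof (rule AE_I2)
      fix u :: real
      have "(\<lambda>n. real (Suc n) * u / (real (Suc n) + u)) \<longlonglongrightarrow> u"
        by real_asymp
      then have "(\<lambda>n. ?t (real (Suc n)) u) \<longlonglongrightarrow> u * u * exp (- (u\<^sup>2 / 2))"
        by (intro tendsto_intros)
      then have "(\<lambda>n. ?t (real (Suc n)) u) \<longlonglongrightarrow> u ^ 2 * exp (- (u\<^sup>2 / 2))"
        by (simp only: power2_eq_square)
      then show "(\<lambda>n. indicator {0..} u *\<^sub>R ?t (real (Suc n)) u) \<longlonglongrightarrow>
          indicator {0..} u *\<^sub>R (u ^ 2 * exp (- (u\<^sup>2 / 2)))"
        by (rule tendsto_scaleR[OF tendsto_const])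
    qed
    show "AE u in lborel. norm (indicator {0..} u *\<^sub>R ?t (real (Suc n)) u) \<le>
        indicator {0..} u *\<^sub>R (u ^ 2 * exp (- (u\<^sup>2 / 2)))" for n
    proof (rule AE_I2)
      fix u :: real
      have "\<bar>?t (real (Suc n)) u\<bar> \<le> u ^ 2 * exp (- (u\<^sup>2 / 2))" if "u \<ge> 0"
        unfolding abs_mult[of _ "exp _"] abs_exp_cancel
        using fraction_bound_square[OF _ that, of "real (Suc n)"] by (intro mult_right_mono) auto
      then show "norm (indicator {0..} u *\<^sub>R ?t (real (Suc n)) u) \<le> indicator {0..} u *\<^sub>R (u ^ 2 * exp (- (u\<^sup>2 / 2)))"
        unfolding real_norm_def by (cases "u \<ge> 0") (simp_all only: indicator_simps atLeast_iff, simp_all)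
    qed
  qed measurable
  then have lim: "(\<lambda>n. LINT u:{0..}|lborel. ?t (real (Suc n)) u) \<longlonglongrightarrow> gauss_moment 0 0"
    using gauss_moment_2[of 0] by (simp add: gauss_moment_def)
  have "(\<lambda>n. res_mean \<rho> (real (Suc n))) \<longlonglongrightarrow>
      gauss_moment 1 \<rho> * (fwd_c \<rho> * gauss_moment 1 \<rho> - 1 / \<rho>\<^sup>2) + 1 / \<rho>\<^sup>2 - gauss_moment 0 0 / \<rho>"
    unfolding res_mean_def[OF assms of_nat_0_less_iff[THEN iffD2, OF zero_less_Suc]]
    by (intro tendsto_intros lim) (use assms in simp)
  also have "gauss_moment 1 \<rho> * (fwd_c \<rho> * gauss_moment 1 \<rho> - 1 / \<rho>\<^sup>2) + 1 / \<rho>\<^sup>2 - gauss_moment 0 0 / \<rho> = fwd_c \<rho> - 1"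
  proof -
    \<comment> \<open>Since \<open>gauss_moment 1 \<rho>\<close> = 1 - p, the coefficient of c is (1
      - p)^2 = 1 - p (2 - p), and the equation c p (2 - p) = a closes the identity.\<close>
    define p where "p = \<rho> * gauss_moment 0 \<rho>"
    have p: "0 < p" "p < 1"
      using assms gauss_moment_pos[of \<rho> 0] mills_lt_inverse[of \<rho>] by (auto simp: p_def)
    have g1: "gauss_moment 1 \<rho> = 1 - p"
      using gauss_moment_1[of \<rho>] assms by (simp add: p_def)
    have "fwd_c \<rho> * (p * (2 - p)) = fwd_a \<rho>"
      unfolding fwd_c_def p_def[symmetric] using p by simp
    moreover have "fwd_a \<rho> = 1 + p / \<rho>\<^sup>2 - gauss_moment 0 0 / \<rho>"
      using assms by (simp add: fwd_a_def p_def power2_eq_square diff_divide_distrib)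
    ultimately show ?thesis
      unfolding g1 by (simp add: algebra_simps diff_divide_distrib)
  qed
  finally show ?thesis .
qed

context forward_process
begin

lemma laplace_autocorrelation:
  assumes "\<rho> > 0"
  shows "(LINT t:{0..}|lborel. exp (- \<rho> * t) * corr (\<lambda>x. x) t) = (1 - fwd_c \<rho> * fwd_a \<rho>) / sqrt (2 * pi)"
proof -
  define N where "N n = real (Suc n)" for n
  have N: "N n > 0" for n by (simp add: N_def)
  let ?m = "\<lambda>n. res_mean \<rho> (N n)"
  let ?h = "\<lambda>n x. \<rho> * res \<rho> (N n) x - L_F (res \<rho> (N n)) x"
  note h = res_resolvent_equation[OF assms N]
  note C1 = res_C1_bounded[OF assms N]
  have m: "?m \<longlonglongrightarrow> fwd_c \<rho> - 1"
    unfolding N_def by (rule res_mean_tendsto[OF assms])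
  obtain B where B: "\<And>n. \<bar>?m n\<bar> \<le> B"
    using convergent_imp_Bseq[OF convergentI[OF m]] unfolding Bseq_def by auto
  have "(\<lambda>n. LINT t:{0..}|lborel. exp (- \<rho> * t) * corr (?h n) t) \<longlonglongrightarrow>
      (LINT t:{0..}|lborel. exp (- \<rho> * t) * corr (\<lambda>x. x) t)"
  \<comment> \<open>The terms |c| + B bound the slope on the right; 1 bounds the coefficient of |x|
    on the left, and 1 / \<rho> the truncation defect.\<close>
  proof (rule corr_laplace_limit[where K = "\<bar>fwd_c \<rho>\<bar> + B + 1 + 1 / \<rho>"])
    show "?h n \<in> borel_measurable borel" for n
    proof -
      have "L_F (res \<rho> (N n)) \<in> borel_measurable borel" "res \<rho> (N n) \<in> borel_measurable borel"
        using R_generator[OF C1[of n]] unfolding extended_generator_def by auto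
      then show ?thesis by measurable
    qed
    have B0: "B \<ge> 0" using B[of 0] by linarith
    show "\<bar>?h n x\<bar> \<le> (\<bar>fwd_c \<rho>\<bar> + B + 1 + 1 / \<rho>) * (1 + \<bar>x\<bar>)" for n x
    proof (cases "x \<ge> 0")
      case True
      have "\<bar>?h n x\<bar> = \<bar>fwd_c \<rho> - ?m n\<bar> * \<bar>x\<bar>"
        unfolding h using True by (simp add: abs_mult)
      also have "\<dots> \<le> (\<bar>fwd_c \<rho>\<bar> + B + 1 + 1 / \<rho>) * (1 + \<bar>x\<bar>)"
      proof (rule mult_mono)
        have "1 / \<rho> \<ge> 0" using assms by simp
        then show "\<bar>fwd_c \<rho> - ?m n\<bar> \<le> \<bar>fwd_c \<rho>\<bar> + B + 1 + 1 / \<rho>"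
          "0 \<le> \<bar>fwd_c \<rho>\<bar> + B + 1 + 1 / \<rho>"
          using B[of n] B0 by linarith+
      qed auto
      finally show ?thesis .
    next
      case False
      then have x: "x \<le> 0" by simp
      note fr = fraction_bounds[OF N x]
      have "(N n / (N n - x))\<^sup>2 \<le> 1"
        using fr[of n] by (intro power_le_one) auto
      then have "\<bar>(1 - (N n / (N n - x))\<^sup>2) / \<rho>\<bar> \<le> 1 / \<rho>"
        using assms by (simp add: abs_divide divide_right_mono del: divide_const_simps)
      then have "\<bar>?h n x\<bar> \<le> \<bar>x\<bar> + 1 / \<rho>"
        unfolding h if_not_P[OF False] using fr(3)[of n] by linarith
      also have "\<dots> \<le> (\<bar>fwd_c \<rho>\<bar> + B + 1 + 1 / \<rho>) * (1 + \<bar>x\<bar>)"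
      proof -
        have "(\<bar>fwd_c \<rho>\<bar> + B + 1 + 1 / \<rho>) * (1 + \<bar>x\<bar>) - (\<bar>x\<bar> + 1 / \<rho>) =
            (\<bar>fwd_c \<rho>\<bar> + B) * (1 + \<bar>x\<bar>) + 1 + 1 / \<rho> * \<bar>x\<bar>"
          by (simp add: algebra_simps)
        also have "\<dots> \<ge> 0"
          using B0 assms by simp
        finally show ?thesis by simp
      qed
      finally show ?thesis .
    qed
    show "(\<lambda>n. ?h n x) \<longlonglongrightarrow> x" for x
    proof (cases "x \<ge> 0")
      case True
      have "(\<lambda>n. x * (fwd_c \<rho> - ?m n)) \<longlonglongrightarrow> x * (fwd_c \<rho> - (fwd_c \<rho> - 1))"
        by (intro tendsto_intros m)
      then show ?thesis unfolding h using True by simp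
    next
      case False
      have "(\<lambda>n. N n * x / (N n - x)) \<longlonglongrightarrow> x" "(\<lambda>n. N n / (N n - x)) \<longlonglongrightarrow> 1"
        unfolding N_def by real_asymp+
      then have "(\<lambda>n. N n * x / (N n - x) + (1 - (N n / (N n - x))\<^sup>2) / \<rho>) \<longlonglongrightarrow> x + (1 - 1\<^sup>2) / \<rho>"
        by (intro tendsto_intros) (use assms in auto)
      then show ?thesis unfolding h using False by simp
    qed
  qed (use assms in auto)
  moreover have "(\<lambda>n. LINT t:{0..}|lborel. exp (- \<rho> * t) * corr (?h n) t) \<longlonglongrightarrow>
      (fwd_c \<rho> * (1 - fwd_a \<rho>) - (fwd_c \<rho> - 1)) / sqrt (2 * pi)"
  proof -
    have "(LINT t:{0..}|lborel. exp (- \<rho> * t) * corr (?h n) t) =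
        (fwd_c \<rho> * (1 - fwd_a \<rho>) - ?m n) / sqrt (2 * pi)" for n
    proof -
      obtain K where K: "\<And>x. \<bar>res \<rho> (N n) x\<bar> \<le> K * (1 + \<bar>x\<bar>)"
        using C1_bounded_growth[OF C1 res_measurable[OF assms N]] by metis
      show ?thesis
        unfolding resolvent_corr[OF C1 assms] corr_0[OF res_measurable[OF assms N] K]
          rayleigh_res_neg[OF assms N] rayleigh_res_pos[OF assms N] ..
    qed
    then show ?thesis
      by (simp only:) (intro tendsto_intros m, simp)
  qed
  ultimately have "(LINT t:{0..}|lborel. exp (- \<rho> * t) * corr (\<lambda>x. x) t) =
      (fwd_c \<rho> * (1 - fwd_a \<rho>) - (fwd_c \<rho> - 1)) / sqrt (2 * pi)"
    by (rule LIMSEQ_unique)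
  then show ?thesis
    by (simp add: algebra_simps)
qed

lemma sigma2_F_eq:
  assumes "\<rho> > 0"
  shows "sigma2_F M R \<rho> = 8 * ((1 - fwd_c \<rho> * fwd_a \<rho>) / sqrt (2 * pi))"
  using laplace_autocorrelation[OF assms] by (simp add: sigma2_F_def corr_def)

lemma sigma2_F_DERIV:
  assumes "\<rho> > 0"
  shows "\<exists>D<0. (sigma2_F M R has_real_derivative D) (at \<rho>)"
proof -
  obtain D where D: "D > 0" "((\<lambda>\<rho>. fwd_c \<rho> * fwd_a \<rho>) has_real_derivative D) (at \<rho>)"
    using fwd_DERIV[OF assms] by blast
  have "((\<lambda>\<rho>. 8 * ((1 - fwd_c \<rho> * fwd_a \<rho>) / sqrt (2 * pi))) has_real_derivative
      8 * ((0 - D) / sqrt (2 * pi))) (at \<rho>)"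
    by (intro DERIV_cmult DERIV_cdivide DERIV_diff DERIV_const D(2))
  \<comment> \<open>The closed form is available for positive arguments, an open set, on which the
    derivative may be transferred.\<close>
  then have "(sigma2_F M R has_real_derivative 8 * ((0 - D) / sqrt (2 * pi))) (at \<rho>)"
    by (rule has_field_derivative_transform_within_open[where S = "{0<..}"])
       (use assms sigma2_F_eq in auto)
  moreover have "8 * ((0 - D) / sqrt (2 * pi)) < 0"
    using D(1) by simp
  ultimately show ?thesis by blast
qed

end

theorem corollary4p4:
  fixes M :: "'a measure" and R :: "real \<Rightarrow> 'a \<Rightarrow> real"
  assumes "prob_space M"
    and "\<And>t. t \<ge> 0 \<Longrightarrow> R t \<in> borel_measurable M"
    and "\<And>\<omega>. \<omega> \<in> space M \<Longrightarrow> piecewise_deterministic_path (\<lambda>t x. x + t) (\<lambda>t. R t \<omega>)"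
    and "markov_process M R"
    and "stationary_process M R"
    and "distributed M lborel (R 0) std_normal_density"
    and "\<And>f. f \<in> C1_bounded \<Longrightarrow> (f, L_F f) \<in> extended_generator M R"
  shows "\<forall>\<rho>>0. sigma2_F M R differentiable (at \<rho>) \<and> deriv (sigma2_F M R) \<rho> < 0"
proof -
  interpret forward_process M R
    by (intro forward_process.intro forward_process_axioms.intro assms)
  show ?thesis
    using sigma2_F_DERIV DERIV_imp_deriv real_differentiable_def by blast
qed

end
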